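(* Suppose that $\widetilde W$ is an irreducible affine Weyl group of rank $\ge3$, with positive root system $\widetilde\Phi^+$. Let $k\in\mathbb Z$ and let $B$ be an infinite biclosed set in $\widetilde\Phi^+$ such that $\widetilde\Phi^+\setminus B$ is also infinite. Then the set $\{w\in\widetilde W\mid l'_B(w)=k\}$ is infinite, where $l'_B$ is the right $B$-twisted length.
   Context: Affine root system: $\Phi$ is a finite irreducible crystallographic root system in a Euclidean space $V$, with Weyl group $W$, standard positive system $\Phi^+$, $\Phi^-=-\Phi^+$, simple system $\Delta$ and highest root $\rho$. Put $V'=V\oplus\mathbb R\delta$ and extend the inner product by $(\delta,v)=0$ for all $v\in V'$. For $\alpha\in\Phi^+$ let $\{\alpha\}^\wedge=\{\alpha+n\delta\mid n\in\mathbb Z_{\ge0}\}$; for $\alpha\in\Phi^-$ let $\{\alpha\}^\wedge=\{\alpha+(n+1)\delta\mid n\in\mathbb Z_{\ge0}\}$; for $\Lambda\subset\Phi$ let $\Lambda^\wedge=\bigcup_{\alpha\in\Lambda}\{\alpha\}^\wedge$. Positive roots: $\widetilde\Phi^+=\Phi^\wedge$; all roots: $\widetilde\Phi=\Phi^\wedge\uplus-\Phi^\wedge$. $\widetilde W$ is the group generated by the reflections $s_\gamma(v)=v-2\frac{(v,\gamma)}{(\gamma,\gamma)}\gamma$, $\gamma\in\widetilde\Phi$; it is a Coxeter group with simple reflections those in the simple roots $\Delta\cup\{\delta-\rho\}$ and length function $l$; its rank is the number of simple reflections. Inversion set: $N(w)=\{\gamma\in\widetilde\Phi^+\mid w^{-1}(\gamma)\in-\widetilde\Phi^+\}$.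 Biclosed: $\Gamma\subset\widetilde\Phi$ is closed if $\alpha,\beta\in\Gamma$, $k_1,k_2\in\mathbb R_{\ge0}$, $k_1\alpha+k_2\beta\in\widetilde\Phi$ imply $k_1\alpha+k_2\beta\in\Gamma$; $B\subset\widetilde\Phi^+$ is biclosed if $B$ and $\widetilde\Phi^+\setminus B$ are both closed. Right twisted length: $l'_B(w)=l(w)-2|N(w)\cap B|$. *)

theory Defs
  imports "HOL-Analysis.Analysis" "HOL-Algebra.Bij" "HOL-Algebra.Generated_Groups"
begin

definition crystallographic_root_system :: "'a::euclidean_space set \<Rightarrow> bool" where
  "crystallographic_root_system \<Phi> \<longleftrightarrow>
     finite \<Phi> \<and> 0 \<notin> \<Phi> \<and> span \<Phi> = UNIV \<and>
     (\<forall>\<alpha>\<in>\<Phi>. \<forall>c. c *\<^sub>R \<alpha> \<in> \<Phi> \<longleftrightarrow> c = 1 \<or> c = -1) \<and>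
     (\<forall>\<alpha>\<in>\<Phi>. \<forall>\<beta>\<in>\<Phi>. \<beta> - (2 * (\<beta> \<bullet> \<alpha>) / (\<alpha> \<bullet> \<alpha>)) *\<^sub>R \<alpha> \<in> \<Phi>) \<and>
     (\<forall>\<alpha>\<in>\<Phi>. \<forall>\<beta>\<in>\<Phi>. 2 * (\<beta> \<bullet> \<alpha>) / (\<alpha> \<bullet> \<alpha>) \<in> \<int>)"

definition irreducible_root_system :: "'a::euclidean_space set \<Rightarrow> bool" where
  "irreducible_root_system \<Phi> \<longleftrightarrow>
     crystallographic_root_system \<Phi> \<and> \<Phi> \<noteq> {} \<and>
     \<not> (\<exists>\<Phi>1 \<Phi>2. \<Phi>1 \<noteq> {} \<and> \<Phi>2 \<noteq> {} \<and> \<Phi>1 \<union> \<Phi>2 = \<Phi> \<and> \<Phi>1 \<inter> \<Phi>2 = {} \<and>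
         (\<forall>\<alpha>\<in>\<Phi>1. \<forall>\<beta>\<in>\<Phi>2. \<alpha> \<bullet> \<beta> = 0))"

definition nonneg_combs :: "'a::real_vector set \<Rightarrow> 'a set" where
  "nonneg_combs \<Delta> = {\<Sum>\<beta>\<in>\<Delta>. c \<beta> *\<^sub>R \<beta> | c. \<forall>\<beta>\<in>\<Delta>. c \<beta> \<ge> 0}"

definition simple_system :: "'a::euclidean_space set \<Rightarrow> 'a set \<Rightarrow> bool" where
  "simple_system \<Phi> \<Delta> \<longleftrightarrow>
     \<Delta> \<subseteq> \<Phi> \<and> independent \<Delta> \<and>
     (\<forall>\<alpha>\<in>\<Phi>. \<alpha> \<in> nonneg_combs \<Delta> \<or> - \<alpha> \<in> nonneg_combs \<Delta>)"

definition pos_roots :: "'a::euclidean_space set \<Rightarrow> 'a set \<Rightarrow> 'a set" where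
  "pos_roots \<Phi> \<Delta> = \<Phi> \<inter> nonneg_combs \<Delta>"

definition neg_roots :: "'a::euclidean_space set \<Rightarrow> 'a set \<Rightarrow> 'a set" where
  "neg_roots \<Phi> \<Delta> = uminus ` pos_roots \<Phi> \<Delta>"

definition highest_root :: "'a::euclidean_space set \<Rightarrow> 'a set \<Rightarrow> 'a \<Rightarrow> bool" where
  "highest_root \<Phi> \<Delta> \<rho> \<longleftrightarrow> \<rho> \<in> \<Phi> \<and> (\<forall>\<alpha>\<in>\<Phi>. \<rho> - \<alpha> \<in> nonneg_combs \<Delta>)"

text \<open>The space \<open>V' = V \<oplus> \<real>\<delta>\<close> is the product type \<open>'a \<times> real\<close>, with \<open>v\<close> in \<open>V\<close>
  identified with \<open>(v, 0)\<close>. The extended form is degenerate (\<open>\<delta>\<close> lies in its radical),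
  so it is not the inner product that the library puts on the product type.\<close>

definition delta :: "'a::euclidean_space \<times> real" where
  "delta = (0, 1)"

definition aff_form :: "'a::euclidean_space \<times> real \<Rightarrow> 'a \<times> real \<Rightarrow> real" where
  "aff_form x y = fst x \<bullet> fst y"

definition aff_refl :: "'a::euclidean_space \<times> real \<Rightarrow> 'a \<times> real \<Rightarrow> 'a \<times> real" where
  "aff_refl \<gamma> v = v - (2 * aff_form v \<gamma> / aff_form \<gamma> \<gamma>) *\<^sub>R \<gamma>"

definition aff_pos_roots :: "'a::euclidean_space set \<Rightarrow> 'a set \<Rightarrow> ('a \<times> real) set" where
  "aff_pos_roots \<Phi> \<Delta> =
     {(\<alpha>, 0) + real n *\<^sub>R delta | \<alpha> n. \<alpha> \<in> pos_roots \<Phi> \<Delta>} \<union>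
     {(\<alpha>, 0) + real (n + 1) *\<^sub>R delta | \<alpha> n. \<alpha> \<in> neg_roots \<Phi> \<Delta>}"

definition aff_roots :: "'a::euclidean_space set \<Rightarrow> 'a set \<Rightarrow> ('a \<times> real) set" where
  "aff_roots \<Phi> \<Delta> = aff_pos_roots \<Phi> \<Delta> \<union> uminus ` aff_pos_roots \<Phi> \<Delta>"

definition aff_simple_roots :: "'a::euclidean_space set \<Rightarrow> 'a \<Rightarrow> ('a \<times> real) set" where
  "aff_simple_roots \<Delta> \<rho> = (\<lambda>\<alpha>. (\<alpha>, 0)) ` \<Delta> \<union> {delta - (\<rho>, 0)}"

definition aff_simple_refls ::
  "'a::euclidean_space set \<Rightarrow> 'a \<Rightarrow> ('a \<times> real \<Rightarrow> 'a \<times> real) set" where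
  "aff_simple_refls \<Delta> \<rho> = aff_refl ` aff_simple_roots \<Delta> \<rho>"

definition aff_rank :: "'a::euclidean_space set \<Rightarrow> 'a \<Rightarrow> nat" where
  "aff_rank \<Delta> \<rho> = card (aff_simple_refls \<Delta> \<rho>)"

definition aff_weyl_group ::
  "'a::euclidean_space set \<Rightarrow> 'a set \<Rightarrow> ('a \<times> real \<Rightarrow> 'a \<times> real) set" where
  "aff_weyl_group \<Phi> \<Delta> = generate (BijGroup UNIV) (aff_refl ` aff_roots \<Phi> \<Delta>)"

definition aff_length ::
  "'a::euclidean_space set \<Rightarrow> 'a \<Rightarrow> ('a \<times> real \<Rightarrow> 'a \<times> real) \<Rightarrow> nat" where
  "aff_length \<Delta> \<rho> w =
     (LEAST n. \<exists>ss. length ss = n \<and> set ss \<subseteq> aff_simple_refls \<Delta> \<rho> \<and> w = foldr (\<circ>) ss id)"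

definition inversion_set ::
  "'a::euclidean_space set \<Rightarrow> 'a set \<Rightarrow> ('a \<times> real \<Rightarrow> 'a \<times> real) \<Rightarrow> ('a \<times> real) set" where
  "inversion_set \<Phi> \<Delta> w =
     {\<gamma> \<in> aff_pos_roots \<Phi> \<Delta>. inv_into UNIV w \<gamma> \<in> uminus ` aff_pos_roots \<Phi> \<Delta>}"

definition closed_roots :: "'a::euclidean_space set \<Rightarrow> 'a set \<Rightarrow> ('a \<times> real) set \<Rightarrow> bool" where
  "closed_roots \<Phi> \<Delta> \<Gamma> \<longleftrightarrow>
     \<Gamma> \<subseteq> aff_roots \<Phi> \<Delta> \<and>
     (\<forall>\<alpha>\<in>\<Gamma>. \<forall>\<beta>\<in>\<Gamma>. \<forall>k1 k2 :: real. k1 \<ge> 0 \<longrightarrow> k2 \<ge> 0 \<longrightarrow>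
        k1 *\<^sub>R \<alpha> + k2 *\<^sub>R \<beta> \<in> aff_roots \<Phi> \<Delta> \<longrightarrow> k1 *\<^sub>R \<alpha> + k2 *\<^sub>R \<beta> \<in> \<Gamma>)"

definition biclosed_roots :: "'a::euclidean_space set \<Rightarrow> 'a set \<Rightarrow> ('a \<times> real) set \<Rightarrow> bool" where
  "biclosed_roots \<Phi> \<Delta> B \<longleftrightarrow>
     B \<subseteq> aff_pos_roots \<Phi> \<Delta> \<and> closed_roots \<Phi> \<Delta> B \<and>
     closed_roots \<Phi> \<Delta> (aff_pos_roots \<Phi> \<Delta> - B)"

definition twisted_length ::
  "'a::euclidean_space set \<Rightarrow> 'a set \<Rightarrow> 'a \<Rightarrow> ('a \<times> real) set \<Rightarrow>
     ('a \<times> real \<Rightarrow> 'a \<times> real) \<Rightarrow> int" where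
  "twisted_length \<Phi> \<Delta> \<rho> B w =
     int (aff_length \<Delta> \<rho> w) - 2 * int (card (inversion_set \<Phi> \<Delta> w \<inter> B))"

end

theory Submission
  imports Defs
begin

text \<open>Multiplying \<open>w\<close> on the right by a simple reflection changes the inversion set by exactly one
  root, so the twisted length satisfies a discrete intermediate value property along every walk
  in the Cayley graph. In each \<open>\<delta>\<close>-string the biclosed set \<open>B\<close> is finite or cofinite; let \<open>P\<close> be the set of
  finite roots whose string is eventually in \<open>B\<close>. Both \<open>P\<close> and \<open>\<Phi> - P\<close> are closed, and by irreducibility
  some \<open>\<alpha> \<in> P\<close> has \<open>- \<alpha> \<notin> P\<close>. The sum \<open>d\<close> of the coroots of all such \<open>\<alpha>\<close> pairs positively with
  each of them and is orthogonal to every root \<open>\<beta>\<close> such that \<open>\<beta>\<close> and \<open>- \<beta>\<close> lie on the same side. Hence the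
  translations by \<open>m d\<close> have inversion sets that lie in \<open>B\<close> up to a bounded error for \<open>m > 0\<close>, and
  outside \<open>B\<close> up to a bounded error for \<open>m < 0\<close>, so the twisted length runs through all
  integers along each line of translations parallel to \<open>d\<close>. As the rank is at least 3, there are
  infinitely many such lines, at growing distance from each other.\<close>

section \<open>Cones spanned by independent sets\<close>

lemma nonneg_combs_base:
  assumes "finite S" "b \<in> S"
  shows "b \<in> nonneg_combs S"
proof -
  have "(\<Sum>x\<in>S. (if x = b then 1 else 0) *\<^sub>R x) = b"
    using assms by (simp add: if_distrib[of "\<lambda>c. c *\<^sub>R _"] sum.delta cong: if_cong)
  then show ?thesis
    unfolding nonneg_combs_def by (intro CollectI exI[of _ "\<lambda>x. if x = b then 1 else 0"]) auto
qed

lemma nonneg_combs_zero: "0 \<in> nonneg_combs S"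
  unfolding nonneg_combs_def by (intro CollectI exI[of _ "\<lambda>x. 0"]) auto

lemma nonneg_combs_add:
  assumes "x \<in> nonneg_combs S" "y \<in> nonneg_combs S"
  shows "x + y \<in> nonneg_combs S"
proof -
  obtain c d where "x = (\<Sum>b\<in>S. c b *\<^sub>R b)" "\<forall>b\<in>S. c b \<ge> 0"
    "y = (\<Sum>b\<in>S. d b *\<^sub>R b)" "\<forall>b\<in>S. d b \<ge> 0"
    using assms unfolding nonneg_combs_def by blast
  then show ?thesis
    unfolding nonneg_combs_def
    by (intro CollectI exI[of _ "\<lambda>b. c b + d b"]) (auto simp: scaleR_left_distrib sum.distrib)
qed

lemma nonneg_combs_scale:
  assumes "x \<in> nonneg_combs S" "r \<ge> 0"
  shows "r *\<^sub>R x \<in> nonneg_combs S"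
proof -
  obtain c where "x = (\<Sum>b\<in>S. c b *\<^sub>R b)" "\<forall>b\<in>S. c b \<ge> 0"
    using assms unfolding nonneg_combs_def by blast
  then show ?thesis
    using assms(2) unfolding nonneg_combs_def
    by (intro CollectI exI[of _ "\<lambda>b. r * c b"]) (auto simp: scaleR_sum_right)
qed

lemma nonneg_combs_sum:
  assumes "\<And>i. i \<in> I \<Longrightarrow> f i \<in> nonneg_combs S"
  shows "sum f I \<in> nonneg_combs S"
  using assms
  by (induction I rule: infinite_finite_induct) (auto intro: nonneg_combs_zero nonneg_combs_add)

section \<open>Coordinate functionals of an independent set\<close>

lemma ex_coordinate:
  assumes "independent S"
  shows "\<exists>g::'v::real_vector \<Rightarrow> real. linear g \<and> (\<forall>x\<in>S. g x = f x)"
  using linear_independent_extend[OF assms] by blast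

lemma nonneg_combs_linear_nonneg:
  fixes g :: "'v::real_vector \<Rightarrow> real"
  assumes "linear g" "\<forall>b\<in>S. g b \<ge> 0" "x \<in> nonneg_combs S"
  shows "g x \<ge> 0"
proof -
  obtain c where "x = (\<Sum>b\<in>S. c b *\<^sub>R b)" "\<forall>b\<in>S. c b \<ge> 0"
    using assms unfolding nonneg_combs_def by blast
  then show ?thesis
    using assms by (auto simp: linear_sum linear_scale intro!: sum_nonneg)
qed

text \<open>The coordinate functional of each \<open>b\<close> is nonnegative on both
  \<open>x\<close> and \<open>- x\<close>, so every coefficient of \<open>x\<close>
  vanishes.\<close>

lemma nonneg_combs_pointed:
  assumes "independent S" "x \<in> nonneg_combs S" "- x \<in> nonneg_combs S"
  shows "x = 0"
proof -
  obtain c where c: "x = (\<Sum>b\<in>S. c b *\<^sub>R b)" "\<forall>b\<in>S. c b \<ge> 0"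
    using assms(2) unfolding nonneg_combs_def by blast
  have "c b = 0" if b: "b \<in> S" and fin: "finite S" for b
  proof -
    obtain g :: "'a \<Rightarrow> real" where g: "linear g" "\<forall>x\<in>S. g x = (if x = b then 1 else 0)"
      using ex_coordinate[OF assms(1), of "\<lambda>x. if x = b then 1 else 0"] by blast
    have "g x = (\<Sum>y\<in>S. c y * g y)"
      by (simp add: c(1) linear_sum[OF g(1)] linear_scale[OF g(1)])
    also have "\<dots> = (\<Sum>y\<in>S. if y = b then c y else 0)"
      using g(2) by (intro sum.cong) auto
    also have "\<dots> = c b" using b fin by simp
    finally have "g x = c b" .
    moreover have "g (- x) \<ge> 0"
      using nonneg_combs_linear_nonneg[OF g(1) _ assms(3)] g(2) by auto
    ultimately show ?thesis
      using c(2) b linear_neg[OF g(1), of x] by fastforce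
  qed
  \<comment> \<open>For infinite \<open>S\<close> the sum is 0 by convention, so
    \<open>x = 0\<close> at once.\<close>
  then show ?thesis using c(1) by (cases "finite S") auto
qed

section \<open>The affine form and its reflections\<close>

lemma linear_aff_refl: "linear (aff_refl \<gamma>)"
  by (intro linearI)
     (auto simp: aff_refl_def aff_form_def algebra_simps inner_simps add_divide_distrib)

lemma aff_refl_pair:
  "aff_refl (\<alpha>, m) (v, c) =
     (v - (2 * (v \<bullet> \<alpha>) / (\<alpha> \<bullet> \<alpha>)) *\<^sub>R \<alpha>, c - (2 * (v \<bullet> \<alpha>) / (\<alpha> \<bullet> \<alpha>)) * m)"
  by (simp add: aff_refl_def aff_form_def)

lemma inner_reflection:
  fixes \<alpha> :: "'v::real_inner"
  assumes "\<alpha> \<noteq> 0"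
  shows "(u - (2 * (u \<bullet> \<alpha>) / (\<alpha> \<bullet> \<alpha>)) *\<^sub>R \<alpha>) \<bullet> (v - (2 * (v \<bullet> \<alpha>) / (\<alpha> \<bullet> \<alpha>)) *\<^sub>R \<alpha>) = u \<bullet> v"
  using assms by (simp add: inner_simps inner_commute field_simps)

lemma aff_form_refl:
  assumes "fst \<gamma> \<noteq> 0"
  shows "aff_form (aff_refl \<gamma> x) (aff_refl \<gamma> y) = aff_form x y"
  using inner_reflection[OF assms, of "fst x" "fst y"] by (simp add: aff_refl_def aff_form_def)

lemma aff_refl_refl:
  assumes "fst \<gamma> \<noteq> 0"
  shows "aff_refl \<gamma> (aff_refl \<gamma> x) = x"
  using assms
  by (cases \<gamma>; cases x) (simp add: aff_refl_pair inner_simps field_simps flip: scaleR_left_distrib)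

lemma aff_refl_self:
  assumes "fst \<gamma> \<noteq> 0"
  shows "aff_refl \<gamma> \<gamma> = - \<gamma>"
  using assms by (cases \<gamma>) (simp add: aff_refl_pair scaleR_2)

lemma aff_refl_uminus: "aff_refl (- \<gamma>) = aff_refl \<gamma>"
  by (intro ext) (simp add: aff_refl_def aff_form_def)

lemma aff_refl_conj:
  assumes "linear w" "\<And>x y. aff_form (w x) (w y) = aff_form x y"
  shows "w (aff_refl \<gamma> x) = aff_refl (w \<gamma>) (w x)"
  by (simp add: aff_refl_def assms(2) linear_diff[OF assms(1)] linear_scale[OF assms(1)])

text \<open>The same expression as in \<open>aff_length\<close>. Under a name of its own it can be
  split, truncated and extended without unfolding the composition.\<close>

definition word :: "('v \<Rightarrow> 'v) list \<Rightarrow> 'v \<Rightarrow> 'v" where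
  "word ss = foldr (\<circ>) ss id"

lemma word_Nil: "word [] = id"
  by (simp only: word_def foldr_Nil id_apply)

lemma word_Cons: "word (s # ss) = s \<circ> word ss"
  by (simp only: word_def foldr_Cons o_apply)

lemma word_append: "word (ss @ ts) = word ss \<circ> word ts"
  by (induction ss) (simp_all only: append_Nil append_Cons word_Nil word_Cons comp_assoc id_o)

lemma word_single: "word [s] = s"
  by (simp only: word_Nil word_Cons o_id)

section \<open>Positive roots and simple reflections\<close>

locale affine_root_datum =
  fixes \<Phi> \<Delta> :: "'a::euclidean_space set" and \<rho> :: 'a
  assumes crystallographic: "crystallographic_root_system \<Phi>"
    and simple: "simple_system \<Phi> \<Delta>"
    and highest: "highest_root \<Phi> \<Delta> \<rho>"
begin

abbreviation pairing :: "'a \<Rightarrow> 'a \<Rightarrow> real" where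
  "pairing v \<alpha> \<equiv> 2 * (v \<bullet> \<alpha>) / (\<alpha> \<bullet> \<alpha>)"

abbreviation fin_refl :: "'a \<Rightarrow> 'a \<Rightarrow> 'a" where
  "fin_refl \<alpha> v \<equiv> v - pairing v \<alpha> *\<^sub>R \<alpha>"

abbreviation "roots \<equiv> aff_roots \<Phi> \<Delta>"
abbreviation "Pos \<equiv> aff_pos_roots \<Phi> \<Delta>"
abbreviation "simple_roots \<equiv> aff_simple_roots \<Delta> \<rho>"
abbreviation "simple_refls \<equiv> aff_simple_refls \<Delta> \<rho>"
abbreviation "inv_map \<equiv> inv_into UNIV"
abbreviation "inv_set \<equiv> inversion_set \<Phi> \<Delta>"

lemma finite_roots: "finite \<Phi>" and root_nonzero: "\<alpha> \<in> \<Phi> \<Longrightarrow> \<alpha> \<noteq> 0"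
  and fin_refl_root: "\<alpha> \<in> \<Phi> \<Longrightarrow> \<beta> \<in> \<Phi> \<Longrightarrow> fin_refl \<alpha> \<beta> \<in> \<Phi>"
  and pairing_Ints: "\<alpha> \<in> \<Phi> \<Longrightarrow> \<beta> \<in> \<Phi> \<Longrightarrow> pairing \<beta> \<alpha> \<in> \<int>"
  and root_scale: "\<alpha> \<in> \<Phi> \<Longrightarrow> c *\<^sub>R \<alpha> \<in> \<Phi> \<longleftrightarrow> c = 1 \<or> c = -1"
  using crystallographic unfolding crystallographic_root_system_def by blast+

lemma root_uminus: "- \<alpha> \<in> \<Phi> \<longleftrightarrow> \<alpha> \<in> \<Phi>"
  using root_scale[of \<alpha> "-1"] root_scale[of "-\<alpha>" "-1"] by auto

lemma Delta_sub: "\<Delta> \<subseteq> \<Phi>" and Delta_indep: "independent \<Delta>"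
  and pos_or_neg: "\<alpha> \<in> \<Phi> \<Longrightarrow> \<alpha> \<in> nonneg_combs \<Delta> \<or> - \<alpha> \<in> nonneg_combs \<Delta>"
  using simple unfolding simple_system_def by auto

lemma finite_Delta: "finite \<Delta>"
  using Delta_sub finite_roots finite_subset by blast

lemma rho_root: "\<rho> \<in> \<Phi>" and rho_highest: "\<alpha> \<in> \<Phi> \<Longrightarrow> \<rho> - \<alpha> \<in> nonneg_combs \<Delta>"
  using highest unfolding highest_root_def by auto

text \<open>Maximality of \<rho> against the root \<open>- \<rho>\<close> puts twice \<rho> into the
  cone.\<close>

lemma rho_nonneg: "\<rho> \<in> nonneg_combs \<Delta>"
  using nonneg_combs_scale[OF rho_highest[of "-\<rho>"], of "1/2"] rho_root
  by (simp add: root_uminus flip: scaleR_2)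

section \<open>Positive affine roots as strings of integer heights\<close>

lemma pos_roots_uminus:
  assumes "\<alpha> \<in> \<Phi>"
  shows "- \<alpha> \<in> pos_roots \<Phi> \<Delta> \<longleftrightarrow> \<alpha> \<notin> pos_roots \<Phi> \<Delta>"
  using assms pos_or_neg[of \<alpha>] nonneg_combs_pointed[OF Delta_indep, of \<alpha>] root_nonzero[of \<alpha>]
  by (auto simp: pos_roots_def root_uminus)

text \<open>The lowest height in the positive string over \<beta>. It merges the two families in
  \<open>aff_pos_roots\<close> into the single description \<open>Pos_iff\<close>, and the negative
  roots over \<beta> become those at heights below \<open>bottom \<beta>\<close>.\<close>

definition bottom :: "'a \<Rightarrow> int" where
  "bottom \<beta> = (if \<beta> \<in> pos_roots \<Phi> \<Delta> then 0 else 1)"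

lemma bottom_uminus: "\<beta> \<in> \<Phi> \<Longrightarrow> bottom (- \<beta>) = 1 - bottom \<beta>"
  by (simp add: bottom_def pos_roots_uminus)

lemma Pos_iff: "(\<beta>, r) \<in> Pos \<longleftrightarrow> \<beta> \<in> \<Phi> \<and> (\<exists>n\<ge>bottom \<beta>. r = real_of_int n)"
proof
  assume "(\<beta>, r) \<in> Pos"
  then consider (pos) n where "\<beta> \<in> pos_roots \<Phi> \<Delta>" "r = real n"
    | (neg) n where "\<beta> \<in> neg_roots \<Phi> \<Delta>" "r = real (n + 1)"
    by (auto simp: aff_pos_roots_def delta_def)
  then show "\<beta> \<in> \<Phi> \<and> (\<exists>n\<ge>bottom \<beta>. r = real_of_int n)"
  proof cases
    case pos
    then show ?thesis
      by (auto simp: bottom_def pos_roots_def intro!: exI[of _ "int n"])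
  next
    case neg
    then obtain \<alpha> where "\<beta> = - \<alpha>" "\<alpha> \<in> pos_roots \<Phi> \<Delta>" by (auto simp: neg_roots_def)
    with neg show ?thesis
      by (auto simp: bottom_def pos_roots_def root_uminus intro!: exI[of _ "int n + 1"])
  qed
next
  assume "\<beta> \<in> \<Phi> \<and> (\<exists>n\<ge>bottom \<beta>. r = real_of_int n)"
  then obtain n where b: "\<beta> \<in> \<Phi>" and n: "n \<ge> bottom \<beta>" "r = real_of_int n" by auto
  show "(\<beta>, r) \<in> Pos"
  proof (cases "\<beta> \<in> pos_roots \<Phi> \<Delta>")
    case True
    with n show ?thesis
      by (auto simp: aff_pos_roots_def delta_def bottom_def intro!: exI[of _ "nat n"])
  next
    case False
    then have "- \<beta> \<in> pos_roots \<Phi> \<Delta>" using b by (simp add: pos_roots_uminus)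
    then have "\<beta> \<in> neg_roots \<Phi> \<Delta>" unfolding neg_roots_def by force
    with n False show ?thesis
      by (auto simp: aff_pos_roots_def delta_def bottom_def intro!: exI[of _ "nat (n - 1)"])
  qed
qed

lemma Neg_iff: "- (\<beta>, r) \<in> Pos \<longleftrightarrow> \<beta> \<in> \<Phi> \<and> (\<exists>n<bottom \<beta>. r = real_of_int n)"
proof -
  have "- (\<beta>, r) \<in> Pos \<longleftrightarrow> \<beta> \<in> \<Phi> \<and> (\<exists>n\<ge>1 - bottom \<beta>. - r = real_of_int n)"
    by (auto simp: Pos_iff root_uminus bottom_uminus)
  also have "\<dots> \<longleftrightarrow> \<beta> \<in> \<Phi> \<and> (\<exists>n<bottom \<beta>. r = real_of_int n)"
  proof (intro conj_cong refl iffI; elim exE conjE)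
    fix n assume "n \<ge> 1 - bottom \<beta>" "- r = real_of_int n"
    then show "\<exists>n<bottom \<beta>. r = real_of_int n" by (intro exI[of _ "-n"]) auto
  next
    fix n assume "n < bottom \<beta>" "r = real_of_int n"
    then show "\<exists>n\<ge>1 - bottom \<beta>. - r = real_of_int n" by (intro exI[of _ "-n"]) auto
  qed
  finally show ?thesis .
qed

lemma uminus_Pos_iff: "\<gamma> \<in> uminus ` Pos \<longleftrightarrow> - \<gamma> \<in> Pos"
  by (metis (no_types, lifting) image_iff minus_minus)

lemma roots_iff: "(\<beta>, r) \<in> roots \<longleftrightarrow> \<beta> \<in> \<Phi> \<and> r \<in> \<int>"
proof -
  have "(\<beta>, r) \<in> roots \<longleftrightarrow> \<beta> \<in> \<Phi> \<and> (\<exists>n. r = real_of_int n)"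
    unfolding aff_roots_def Un_iff uminus_Pos_iff Pos_iff Neg_iff by (metis not_le)
  then show ?thesis by (auto simp: Ints_def)
qed

lemma roots_split: "\<gamma> \<in> roots \<longleftrightarrow> \<gamma> \<in> Pos \<or> - \<gamma> \<in> Pos"
  by (simp add: aff_roots_def uminus_Pos_iff)

lemma Pos_not_neg: "\<gamma> \<in> Pos \<Longrightarrow> - \<gamma> \<notin> Pos"
  by (cases \<gamma>) (auto simp only: Pos_iff Neg_iff of_int_eq_iff)

lemma roots_fst: "\<gamma> \<in> roots \<Longrightarrow> fst \<gamma> \<noteq> 0"
  using root_nonzero by (cases \<gamma>) (auto simp: roots_iff)

lemma aff_refl_roots:
  assumes "\<gamma> \<in> roots" "\<eta> \<in> roots"
  shows "aff_refl \<gamma> \<eta> \<in> roots"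
proof -
  obtain \<alpha> m \<beta> n where g: "\<gamma> = (\<alpha>, m)" "\<eta> = (\<beta>, n)" by (cases \<gamma>; cases \<eta>)
  then have "\<alpha> \<in> \<Phi>" "\<beta> \<in> \<Phi>" "m \<in> \<int>" "n \<in> \<int>" using assms by (auto simp: roots_iff)
  then show ?thesis
    unfolding g aff_refl_pair roots_iff
    by (intro conjI fin_refl_root Ints_diff Ints_mult pairing_Ints)
qed

section \<open>The affine simple system\<close>

lemma simple_roots_Pos: "a \<in> simple_roots \<Longrightarrow> a \<in> Pos"
proof -
  have "\<alpha> \<in> pos_roots \<Phi> \<Delta>" if "\<alpha> \<in> \<Delta>" for \<alpha>
    using that Delta_sub nonneg_combs_base[OF finite_Delta] by (auto simp: pos_roots_def)
  moreover have "- \<rho> \<notin> pos_roots \<Phi> \<Delta>"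
    using rho_root rho_nonneg pos_roots_uminus[of \<rho>] by (simp add: pos_roots_def)
  moreover assume "a \<in> simple_roots"
  ultimately show ?thesis
    using Delta_sub rho_root
    by (auto simp: aff_simple_roots_def delta_def Pos_iff bottom_def root_uminus intro: exI[of _ "0::int"] exI[of _ "1::int"])
qed

lemma simple_roots_roots: "a \<in> simple_roots \<Longrightarrow> a \<in> roots"
  using simple_roots_Pos roots_split by blast

lemma finite_simple_roots: "finite simple_roots"
  using finite_Delta by (simp add: aff_simple_roots_def)

text \<open>The roots of \<Delta> span only vectors with \<open>delta\<close>-coordinate 0, while
  the additional simple root has \<open>delta\<close>-coordinate 1.\<close>

lemma simple_roots_indep: "independent simple_roots"
proof -
  let ?i = "\<lambda>\<alpha>::'a. (\<alpha>, 0::real)"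
  have lin: "linear ?i" by (intro linearI) auto
  have "independent (?i ` \<Delta>)"
    using Delta_indep by (intro linear_independent_injective_image lin) (auto simp: inj_on_def)
  moreover have "delta - (\<rho>, 0) \<notin> span (?i ` \<Delta>)"
    by (auto simp: linear_span_image[OF lin] delta_def)
  ultimately show ?thesis
    by (simp add: aff_simple_roots_def independent_insertI)
qed

text \<open>Writing \<open>n *\<^sub>R delta\<close> as n copies of
  \<open>delta - (\<rho>, 0)\<close> plus n copies of \<rho> leaves a vector of V. For positive
  \<beta> it is in the cone of \<Delta> since \<rho> is. For negative \<beta> at least one \<rho> is
  available, and \<open>\<rho> + \<beta>\<close> is in the cone because \<rho> is the highest
  root.\<close>

lemma Pos_nonneg_combs:
  assumes "\<gamma> \<in> Pos"
  shows "\<gamma> \<in> nonneg_combs simple_roots"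
proof -
  have fin: "(v, 0) \<in> nonneg_combs simple_roots" if v: "v \<in> nonneg_combs \<Delta>" for v
  proof -
    obtain c where c: "v = (\<Sum>b\<in>\<Delta>. c b *\<^sub>R b)" "\<forall>b\<in>\<Delta>. c b \<ge> 0"
      using v unfolding nonneg_combs_def by blast
    have "(v, 0::real) = (\<Sum>b\<in>\<Delta>. c b *\<^sub>R (b, 0))"
      by (simp add: c(1) prod_eq_iff fst_sum snd_sum)
    also have "\<dots> \<in> nonneg_combs simple_roots"
      using c(2) finite_simple_roots
      by (intro nonneg_combs_sum nonneg_combs_scale nonneg_combs_base)
         (auto simp: aff_simple_roots_def)
    finally show ?thesis .
  qed
  have top: "delta - (\<rho>, 0) \<in> nonneg_combs simple_roots"
    using finite_simple_roots by (intro nonneg_combs_base) (auto simp: aff_simple_roots_def)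
  obtain \<beta> n where g: "\<gamma> = (\<beta>, real_of_int n)" "\<beta> \<in> \<Phi>" "n \<ge> bottom \<beta>"
    using assms by (cases \<gamma>) (auto simp: Pos_iff)
  show ?thesis
  proof (cases "\<beta> \<in> pos_roots \<Phi> \<Delta>")
    case True
    then have "n \<ge> 0" "\<beta> \<in> nonneg_combs \<Delta>" using g by (auto simp: bottom_def pos_roots_def)
    moreover have "\<gamma> = (\<beta> + real_of_int n *\<^sub>R \<rho>, 0) + real_of_int n *\<^sub>R (delta - (\<rho>, 0))"
      by (simp add: g delta_def)
    ultimately show ?thesis
      by (auto intro!: nonneg_combs_add nonneg_combs_scale fin top rho_nonneg)
  next
    case False
    then have "n \<ge> 1" using g by (auto simp: bottom_def)
    moreover have "\<rho> + \<beta> \<in> nonneg_combs \<Delta>" using rho_highest[of "-\<beta>"] g by (simp add: root_uminus)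
    moreover have "\<gamma> = ((\<rho> + \<beta>) + (real_of_int n - 1) *\<^sub>R \<rho>, 0) + real_of_int n *\<^sub>R (delta - (\<rho>, 0))"
      by (simp add: g delta_def algebra_simps)
    ultimately show ?thesis
      by (auto intro!: nonneg_combs_add nonneg_combs_scale fin top rho_nonneg)
  qed
qed

text \<open>The reflection changes only the coefficient at \<open>a\<close>. If the image were
  negative, all other coefficients of \<gamma> would be both nonnegative and nonpositive, so
  \<gamma> would be a multiple of \<open>a\<close>, and the only positive such root is
  \<open>a\<close> itself.\<close>

lemma simple_refl_Pos:
  assumes a: "a \<in> simple_roots" and g: "\<gamma> \<in> Pos" "\<gamma> \<noteq> a"
  shows "aff_refl a \<gamma> \<in> Pos"
proof (rule ccontr)
  assume "aff_refl a \<gamma> \<notin> Pos"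
  then have neg: "- aff_refl a \<gamma> \<in> Pos"
    using aff_refl_roots[of a \<gamma>] simple_roots_roots[OF a] g roots_split by blast
  obtain c where c: "\<gamma> = (\<Sum>b\<in>simple_roots. c b *\<^sub>R b)" "\<forall>b\<in>simple_roots. c b \<ge> 0"
    using Pos_nonneg_combs[OF g(1)] unfolding nonneg_combs_def by blast
  have "c b = 0" if b: "b \<in> simple_roots" "b \<noteq> a" for b
  proof -
    obtain f :: "'a \<times> real \<Rightarrow> real" where f: "linear f" "\<forall>x\<in>simple_roots. f x = (if x = b then 1 else 0)"
      using ex_coordinate[OF simple_roots_indep, of "\<lambda>x. if x = b then 1 else 0"] by blast
    have "f \<gamma> = (\<Sum>y\<in>simple_roots. c y * f y)"
      by (simp add: c(1) linear_sum[OF f(1)] linear_scale[OF f(1)])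
    also have "\<dots> = (\<Sum>y\<in>simple_roots. if y = b then c y else 0)"
      using f(2) by (intro sum.cong) auto
    also have "\<dots> = c b" using b finite_simple_roots by simp
    finally have fg: "f \<gamma> = c b" .
    have "f (aff_refl a \<gamma>) = f \<gamma>"
      using f(2) a b(2) by (simp add: aff_refl_def linear_diff[OF f(1)] linear_scale[OF f(1)])
    moreover have "f (- aff_refl a \<gamma>) \<ge> 0"
      using nonneg_combs_linear_nonneg[OF f(1) _ Pos_nonneg_combs[OF neg]] f(2) by auto
    ultimately show ?thesis using fg c(2) b by (simp add: linear_neg[OF f(1)]) (metis order_antisym)
  qed
  then have "\<gamma> = (\<Sum>b\<in>simple_roots. if b = a then c a *\<^sub>R a else 0)"
    unfolding c(1) by (intro sum.cong) auto
  then have ga: "\<gamma> = c a *\<^sub>R a" using a finite_simple_roots by simp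
  have "fst \<gamma> \<in> \<Phi>" "fst a \<in> \<Phi>"
    using g simple_roots_Pos[OF a] by (cases \<gamma>; cases a; auto simp: Pos_iff)+
  then have "c a = 1 \<or> c a = -1" using ga root_scale by simp
  moreover have "c a \<ge> 0" using c(2) a by blast
  ultimately show False using ga g by auto
qed

lemma simple_refl_Pos_iff:
  assumes a: "a \<in> simple_roots" and g: "\<gamma> \<in> roots" "\<gamma> \<noteq> a" "\<gamma> \<noteq> - a"
  shows "aff_refl a \<gamma> \<in> Pos \<longleftrightarrow> \<gamma> \<in> Pos"
proof -
  have "aff_refl a \<gamma> \<notin> Pos" if "- \<gamma> \<in> Pos"
  proof -
    have "aff_refl a (- \<gamma>) \<in> Pos" using simple_refl_Pos[OF a that] g(3) by (metis minus_minus)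
    then show ?thesis using Pos_not_neg linear_neg[OF linear_aff_refl] by (metis minus_minus)
  qed
  then show ?thesis using simple_refl_Pos[OF a] g roots_split Pos_not_neg by blast
qed

section \<open>Words in the simple reflections\<close>

text \<open>The group generated by the simple reflections, given concretely as a set of products, so
  that every element comes with a path in the Cayley graph.\<close>

definition words :: "('a \<times> real \<Rightarrow> 'a \<times> real) set" where
  "words = {word ss | ss. set ss \<subseteq> simple_refls}"

lemma simple_reflsE:
  assumes "s \<in> simple_refls"
  obtains a where "a \<in> simple_roots" "s = aff_refl a"
  using assms by (auto simp: aff_simple_refls_def)

lemma words_id: "id \<in> words"
  unfolding words_def by (intro CollectI exI[of _ "[]"]) (simp add: word_Nil del: id_apply)

lemma words_comp: "u \<in> words \<Longrightarrow> v \<in> words \<Longrightarrow> u \<circ> v \<in> words"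
  unfolding words_def using word_append by (smt (verit) CollectD CollectI set_append Un_least)

lemma words_simple: "a \<in> simple_roots \<Longrightarrow> aff_refl a \<in> words"
  unfolding words_def by (intro CollectI exI[of _ "[aff_refl a]"]) (auto simp: word_single aff_simple_refls_def)

lemma words_induct [consumes 1, case_names id step]:
  assumes "w \<in> words" "Q id" "\<And>a v. a \<in> simple_roots \<Longrightarrow> v \<in> words \<Longrightarrow> Q v \<Longrightarrow> Q (aff_refl a \<circ> v)"
  shows "Q w"
proof -
  have "Q (word ss)" if "set ss \<subseteq> simple_refls" for ss
    using that
  proof (induction ss)
    case (Cons s ss)
    then obtain a where "a \<in> simple_roots" "s = aff_refl a" by (auto elim: simple_reflsE)
    moreover have "word ss \<in> words" using Cons.prems unfolding words_def by auto
    moreover have "Q (word ss)" using Cons by simp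
    ultimately show ?case using assms(3)[of a "word ss"] unfolding word_Cons by blast
  qed (simp only: word_Nil assms(2))
  then show ?thesis using assms(1) unfolding words_def by blast
qed

lemma words_linear: "w \<in> words \<Longrightarrow> linear w"
  by (induction rule: words_induct) (rule linear_id, rule linear_compose, auto intro: linear_aff_refl)

lemma words_form: "w \<in> words \<Longrightarrow> aff_form (w x) (w y) = aff_form x y"
  by (induction arbitrary: x y rule: words_induct)
     (auto simp: aff_form_refl roots_fst simple_roots_roots)

lemma words_roots: "w \<in> words \<Longrightarrow> \<gamma> \<in> roots \<Longrightarrow> w \<gamma> \<in> roots"
  by (induction rule: words_induct) (auto intro: aff_refl_roots simple_roots_roots)

lemma words_inverse: "w \<in> words \<Longrightarrow> \<exists>v\<in>words. v \<circ> w = id \<and> w \<circ> v = id"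
proof (induction rule: words_induct)
  case (step a v)
  then obtain u where u: "u \<in> words" "u \<circ> v = id" "v \<circ> u = id" by blast
  have aa: "aff_refl a \<circ> aff_refl a = id"
    using step(1) by (auto simp: fun_eq_iff aff_refl_refl roots_fst simple_roots_roots)
  show ?case
  proof (intro bexI conjI)
    show "u \<circ> aff_refl a \<in> words" using u step by (auto intro: words_comp words_simple)
    show "u \<circ> aff_refl a \<circ> (aff_refl a \<circ> v) = id" using aa u by (metis comp_assoc comp_id)
    show "aff_refl a \<circ> v \<circ> (u \<circ> aff_refl a) = id" using aa u by (metis comp_assoc comp_id)
  qed
qed (use words_id in \<open>metis id_o\<close>)

lemma words_bij: "w \<in> words \<Longrightarrow> bij w"
  using words_inverse o_bij by blast

lemma words_inv: "w \<in> words \<Longrightarrow> inv_map w \<in> words"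
  using words_inverse inv_unique_comp by metis

text \<open>This inclusion transfers the elements constructed in \<open>words\<close> to the group
  defined by all reflections.\<close>

lemma words_in_group: "w \<in> words \<Longrightarrow> w \<in> aff_weyl_group \<Phi> \<Delta>"
proof (induction rule: words_induct)
  case id
  have "\<one>\<^bsub>BijGroup (UNIV :: ('a \<times> real) set)\<^esub> = id"
    by (auto simp: BijGroup_def fun_eq_iff)
  then show ?case
    unfolding aff_weyl_group_def using generate.one by metis
next
  case (step a v)
  have "bij (aff_refl a)" "bij v" using step words_bij words_simple by auto
  then have "aff_refl a \<otimes>\<^bsub>BijGroup UNIV\<^esub> v = aff_refl a \<circ> v"
    by (auto simp: BijGroup_def Bij_def fun_eq_iff compose_def)
  then show ?case
    using step generate.eng[OF generate.incl[of "aff_refl a" "aff_refl ` roots" "BijGroup UNIV"], of v]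
      simple_roots_roots
    unfolding aff_weyl_group_def by (metis imageI)
qed

text \<open>Read from the right, the letters of the word carry \<open>a\<close> through a chain of
  roots. Where the chain first leaves the positive roots, the suffix \<open>v\<close> sends
  \<open>a\<close> to the simple root \<open>b\<close> of the next letter. Conjugation by
  \<open>v\<close> turns the reflection in \<open>a\<close> into that letter, so the two
  cancel.\<close>

lemma exchange:
  assumes "set ss \<subseteq> simple_refls" "a \<in> simple_roots" "word ss a \<notin> Pos"
  shows "\<exists>ts. set ts \<subseteq> simple_refls \<and> Suc (length ts) = length ss \<and>
           word ss \<circ> aff_refl a = word ts"
  using assms
proof (induction ss)
  case Nil
  then show ?case using simple_roots_Pos by (auto simp: word_Nil)
next
  case (Cons s ss)
  obtain b where b: "b \<in> simple_roots" "s = aff_refl b"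
    using Cons.prems by (auto elim: simple_reflsE)
  define v where "v = word ss"
  have v: "v \<in> words" using Cons.prems by (auto simp: words_def v_def)
  show ?case
  proof (cases "v a \<in> Pos")
    case False
    then obtain ts where "set ts \<subseteq> simple_refls" "Suc (length ts) = length ss"
      "v \<circ> aff_refl a = word ts"
      using Cons.IH[OF _ Cons.prems(2)] Cons.prems(1) unfolding v_def
      by (metis set_subset_Cons subset_trans)
    then show ?thesis
      using Cons.prems by (intro exI[of _ "s # ts"]) (auto simp: v_def word_Cons comp_assoc simp del: o_apply)
  next
    case True
    have "aff_refl b (v a) \<notin> Pos" using Cons.prems(3) by (simp add: v_def b word_Cons)
    \<comment> \<open>A simple reflection makes only its own simple root negative.\<close>
    then have "v a = b" using simple_refl_Pos[OF b(1) True] by blast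
    then have "s \<circ> v \<circ> aff_refl a = v"
      using aff_refl_conj[OF words_linear[OF v] words_form[OF v], of a]
      by (auto simp: fun_eq_iff b aff_refl_refl roots_fst simple_roots_roots)
    then show ?thesis
      using Cons.prems by (intro exI[of _ ss]) (auto simp: v_def word_Cons comp_assoc simp del: o_apply)
  qed
qed

section \<open>Inversion sets and the length function\<close>

lemma inv_set_id: "inv_set id = {}"
  using Pos_not_neg by (auto simp: inversion_set_def uminus_Pos_iff)

lemma inv_set_iff: "\<gamma> \<in> inv_set w \<longleftrightarrow> \<gamma> \<in> Pos \<and> - inv_map w \<gamma> \<in> Pos"
  by (auto simp: inversion_set_def uminus_Pos_iff)

text \<open>The inverse of the product is the inverse of \<open>w\<close> followed by the reflection
  in \<open>a\<close>. It sends \<open>w a\<close> to \<open>- a\<close>, and for any other positive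
  root the reflection does not change the sign of the image, since that image is neither
  \<open>a\<close> nor \<open>- a\<close>.\<close>

lemma inv_set_step:
  assumes w: "w \<in> words" and a: "a \<in> simple_roots" and p: "w a \<in> Pos"
  shows "inv_set (w \<circ> aff_refl a) = insert (w a) (inv_set w)" "w a \<notin> inv_set w"
proof -
  have inv: "inv_map (w \<circ> aff_refl a) \<gamma> = aff_refl a (inv_map w \<gamma>)" for \<gamma>
  proof (rule inv_f_eq)
    show "inj (w \<circ> aff_refl a)"
      using w a by (intro bij_is_inj words_bij words_comp words_simple)
    show "(w \<circ> aff_refl a) (aff_refl a (inv_map w \<gamma>)) = \<gamma>"
      using words_bij[OF w] a
      by (simp add: aff_refl_refl roots_fst simple_roots_roots surj_f_inv_f bij_is_surj)
  qed
  have invwa: "inv_map w (w a) = a" using words_bij[OF w] by (simp add: bij_is_inj)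
  show "w a \<notin> inv_set w" using invwa Pos_not_neg simple_roots_Pos[OF a] by (auto simp: inv_set_iff)
  have aa: "aff_refl a a = - a" using a by (simp add: aff_refl_self roots_fst simple_roots_roots)
  have ne: "- aff_refl a (inv_map w \<gamma>) \<in> Pos \<longleftrightarrow> - inv_map w \<gamma> \<in> Pos" if g: "\<gamma> \<in> Pos" "\<gamma> \<noteq> w a" for \<gamma>
  proof -
    have r: "- inv_map w \<gamma> \<in> roots"
      using g(1) words_roots[OF words_inv[OF w]] roots_split[of "inv_map w \<gamma>"] roots_split[of \<gamma>]
        roots_split[of "- inv_map w \<gamma>"] by auto
    have 1: "inv_map w \<gamma> \<noteq> a" using g(2) words_bij[OF w] by (metis bij_inv_eq_iff)
    have 2: "inv_map w \<gamma> \<noteq> - a"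
    proof
      assume "inv_map w \<gamma> = - a"
      then have "\<gamma> = w (- a)" using words_bij[OF w] by (metis bij_inv_eq_iff)
      then show False using g(1) p Pos_not_neg linear_neg[OF words_linear[OF w]] by metis
    qed
    have "aff_refl a (- inv_map w \<gamma>) \<in> Pos \<longleftrightarrow> - inv_map w \<gamma> \<in> Pos"
      using 1 2 by (intro simple_refl_Pos_iff a r) (auto simp: minus_equation_iff)
    then show ?thesis by (simp add: linear_neg[OF linear_aff_refl])
  qed
  show "inv_set (w \<circ> aff_refl a) = insert (w a) (inv_set w)"
  proof (rule Set.set_eqI)
    fix \<gamma>
    show "\<gamma> \<in> inv_set (w \<circ> aff_refl a) \<longleftrightarrow> \<gamma> \<in> insert (w a) (inv_set w)"
      using ne[of \<gamma>] p simple_roots_Pos[OF a] by (cases "\<gamma> = w a") (auto simp: inv_set_iff inv invwa aa)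
  qed
qed

text \<open>This is \<open>inv_set_step\<close> for \<open>w \<circ> aff_refl a\<close>, which sends
  \<open>a\<close> to the positive root \<open>- w a\<close>.\<close>

lemma inv_set_step_neg:
  assumes w: "w \<in> words" and a: "a \<in> simple_roots" and p: "w a \<notin> Pos"
  shows "inv_set w = insert (- w a) (inv_set (w \<circ> aff_refl a))" "- w a \<notin> inv_set (w \<circ> aff_refl a)"
proof -
  have aa: "aff_refl a a = - a" using a by (simp add: aff_refl_self roots_fst simple_roots_roots)
  have "- w a \<in> Pos" using p words_roots[OF w] a roots_split simple_roots_roots by blast
  moreover have "(w \<circ> aff_refl a) a = - w a" by (simp add: aa linear_neg[OF words_linear[OF w]])
  moreover have "w \<circ> aff_refl a \<circ> aff_refl a = w"
    using a by (auto simp: fun_eq_iff aff_refl_refl roots_fst simple_roots_roots)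
  ultimately show "inv_set w = insert (- w a) (inv_set (w \<circ> aff_refl a))"
    "- w a \<notin> inv_set (w \<circ> aff_refl a)"
    using inv_set_step[of "w \<circ> aff_refl a" a] a w by (auto simp: words_comp words_simple)
qed

text \<open>Words grow on the right here, the side on which \<open>inv_set_step\<close> controls the
  inversion set.\<close>

lemma words_rev_induct [consumes 1, case_names id step]:
  assumes "w \<in> words" "Q id" "\<And>a v. a \<in> simple_roots \<Longrightarrow> v \<in> words \<Longrightarrow> Q v \<Longrightarrow> Q (v \<circ> aff_refl a)"
  shows "Q w"
proof -
  have "Q (word ss)" if "set ss \<subseteq> simple_refls" for ss
    using that
  proof (induction ss rule: rev_induct)
    case (snoc s ss)
    then obtain a where "a \<in> simple_roots" "s = aff_refl a" by (auto elim: simple_reflsE)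
    moreover have "word ss \<in> words" using snoc.prems unfolding words_def by auto
    moreover have "Q (word ss)" using snoc by simp
    ultimately show ?case using assms(3)[of a "word ss"] unfolding word_append word_single by blast
  qed (simp only: word_Nil assms(2))
  then show ?thesis using assms(1) unfolding words_def by blast
qed

lemma finite_inv_set: "w \<in> words \<Longrightarrow> finite (inv_set w)"
proof (induction rule: words_rev_induct)
  case (step a v)
  then show ?case
    using inv_set_step[of v a] inv_set_step_neg[of v a] by (metis finite_insert)
qed (metis finite.emptyI inv_set_id)

text \<open>In a shortest word each new letter adds one inversion; otherwise \<open>exchange\<close>
  would yield a shorter word.\<close>

lemma card_inv_set_minimal_word:
  assumes "set ss \<subseteq> simple_refls"
    and "\<And>ts. set ts \<subseteq> simple_refls \<Longrightarrow> word ts = word ss \<Longrightarrow> length ss \<le> length ts"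
  shows "card (inv_set (word ss)) = length ss"
  using assms
proof (induction ss rule: rev_induct)
  case Nil
  then show ?case using inv_set_id by (metis card.empty list.size(3) word_Nil)
next
  case (snoc s ss)
  define v where "v = word ss"
  obtain a where a: "a \<in> simple_roots" "s = aff_refl a"
    using snoc.prems by (auto elim: simple_reflsE)
  have v: "v \<in> words" using snoc.prems by (auto simp: v_def words_def)
  have vs: "word (ss @ [s]) = v \<circ> aff_refl a" by (simp only: word_append word_single v_def a)
  have "v a \<in> Pos"
  proof (rule ccontr)
    assume "v a \<notin> Pos"
    then obtain ts where "set ts \<subseteq> simple_refls" "Suc (length ts) = length ss"
      "v \<circ> aff_refl a = word ts"
      using exchange[of ss a] snoc.prems a v_def by auto
    then show False using snoc.prems(2)[of ts] vs by auto
  qed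
  then have "card (inv_set (v \<circ> aff_refl a)) = Suc (card (inv_set v))"
    using inv_set_step[OF v a(1)] finite_inv_set[OF v] by simp
  moreover have "card (inv_set v) = length ss"
    unfolding v_def
  proof (rule snoc.IH)
    \<comment> \<open>Prefixes of a shortest word are shortest: a competitor for the prefix extends
      by \<open>s\<close> to a competitor for the whole word.\<close>
    fix ts assume ts: "set ts \<subseteq> simple_refls" "word ts = word ss"
    have "length (ss @ [s]) \<le> length (ts @ [s])"
      using ts snoc.prems(1) by (intro snoc.prems(2)) (auto simp: word_append)
    then show "length ss \<le> length ts" by simp
  qed (use snoc.prems in auto)
  ultimately show ?case using vs by (metis length_append_singleton)
qed

lemma aff_length_inv_set:
  assumes "w \<in> words"
  shows "aff_length \<Delta> \<rho> w = card (inv_set w)"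
proof -
  let ?Q = "\<lambda>n. \<exists>ss. length ss = n \<and> set ss \<subseteq> simple_refls \<and> w = word ss"
  have "\<exists>n. ?Q n" using assms by (auto simp: words_def)
  then have "?Q (aff_length \<Delta> \<rho> w)" unfolding aff_length_def word_def by (rule LeastI_ex)
  then obtain ss where ss: "length ss = aff_length \<Delta> \<rho> w" "set ss \<subseteq> simple_refls" "w = word ss"
    by blast
  have "length ss \<le> length ts" if "set ts \<subseteq> simple_refls" "word ts = w" for ts
    unfolding ss(1) aff_length_def using that unfolding word_def by (intro Least_le) auto
  then show ?thesis using card_inv_set_minimal_word[OF ss(2)] ss by auto
qed

text \<open>Induction on the height \<open>h\<close>, the sum of the simple coefficients. A positive
  root that is not simple has a simple root \<open>b\<close> with which it pairs positively.
  Reflecting in \<open>b\<close> lowers its height and keeps it positive, and the two reflections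
  are conjugate under the reflection in \<open>b\<close>.\<close>

lemma refl_in_words:
  assumes "\<gamma> \<in> roots"
  shows "aff_refl \<gamma> \<in> words"
proof -
  obtain h :: "'a \<times> real \<Rightarrow> real" where h: "linear h" "\<forall>b\<in>simple_roots. h b = 1"
    using ex_coordinate[OF simple_roots_indep, of "\<lambda>_. 1"] by blast
  have nn: "h \<gamma> \<ge> 0" if "\<gamma> \<in> Pos" for \<gamma>
    using nonneg_combs_linear_nonneg[OF h(1) _ Pos_nonneg_combs[OF that]] h(2) by simp
  \<comment> \<open>The height is a real number, so the induction runs over a natural upper bound;
    each reflection lowers the height by at least 1.\<close>
  have "aff_refl \<gamma> \<in> words" if "\<gamma> \<in> Pos" "h \<gamma> \<le> real n" for \<gamma> n
    using that
  proof (induction n arbitrary: \<gamma> rule: less_induct)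
    case (less n)
    show ?case
    proof (cases "\<gamma> \<in> simple_roots")
      case False
      obtain c where c: "\<gamma> = (\<Sum>b\<in>simple_roots. c b *\<^sub>R b)" "\<forall>b\<in>simple_roots. c b \<ge> 0"
        using Pos_nonneg_combs[OF less.prems(1)] unfolding nonneg_combs_def by blast
      have g: "\<gamma> \<in> roots" using less.prems roots_split by blast
      have "aff_form \<gamma> \<gamma> = (\<Sum>b\<in>simple_roots. c b * aff_form \<gamma> b)"
      proof -
        have "fst \<gamma> \<bullet> fst \<gamma> = fst \<gamma> \<bullet> fst (\<Sum>b\<in>simple_roots. c b *\<^sub>R b)" using c(1) by simp
        also have "\<dots> = (\<Sum>b\<in>simple_roots. c b * (fst \<gamma> \<bullet> fst b))"
          by (simp add: fst_sum inner_sum_right)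
        finally show ?thesis by (simp add: aff_form_def)
      qed
      moreover have "aff_form \<gamma> \<gamma> > 0" using roots_fst[OF g] by (simp add: aff_form_def)
      \<comment> \<open>A positive sum has a positive term.\<close>
      ultimately obtain b where b: "b \<in> simple_roots" "c b * aff_form \<gamma> b > 0"
        by (metis (no_types, lifting) not_less sum_nonpos)
      then have pos: "aff_form \<gamma> b > 0" using c(2) by (simp add: zero_less_mult_iff) (metis not_less)
      let ?k = "2 * aff_form \<gamma> b / aff_form b b"
      have "?k \<in> \<int>"
        using g simple_roots_roots[OF b(1)] pairing_Ints
        by (cases \<gamma>; cases b) (auto simp: aff_form_def roots_iff)
      moreover have "?k > 0"
        using pos roots_fst[OF simple_roots_roots[OF b(1)]] by (simp add: aff_form_def)
      ultimately have k: "?k \<ge> 1" by (auto simp: Ints_def)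
      let ?g = "aff_refl b \<gamma>"
      have gp: "?g \<in> Pos" using simple_refl_Pos[OF b(1) less.prems(1)] b False by auto
      have hg: "h ?g = h \<gamma> - ?k"
        using h(2) b(1) by (simp add: aff_refl_def linear_diff[OF h(1)] linear_scale[OF h(1)])
      have "n \<ge> 1" using nn[OF gp] hg k less.prems(2) by (cases n) auto
      then have "aff_refl ?g \<in> words"
        using hg k less.prems by (intro less.IH[of "n - 1"] gp) auto
      moreover have "aff_refl \<gamma> = aff_refl b \<circ> aff_refl ?g \<circ> aff_refl b"
      proof
        fix x
        have fb: "fst b \<noteq> 0" using roots_fst simple_roots_roots b by blast
        have "aff_refl b (aff_refl ?g (aff_refl b x)) = aff_refl (aff_refl b ?g) (aff_refl b (aff_refl b x))"
          by (rule aff_refl_conj[OF linear_aff_refl]) (simp add: aff_form_refl fb)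
        then show "aff_refl \<gamma> x = (aff_refl b \<circ> aff_refl ?g \<circ> aff_refl b) x"
          by (simp add: aff_refl_refl fb)
      qed
      ultimately show ?thesis using b by (metis words_comp words_simple)
    qed (rule words_simple)
  qed
  then have pos: "aff_refl \<gamma> \<in> words" if "\<gamma> \<in> Pos" for \<gamma>
    using that real_nat_ceiling_ge by blast
  show ?thesis
    using assms pos[of \<gamma>] pos[of "- \<gamma>"] by (auto simp: roots_split aff_refl_uminus)
qed

section \<open>Translations\<close>

text \<open>The linear action on the root space of a translation parallel to \<open>l\<close> in the
  affine picture: a shear along \<open>delta\<close>.\<close>

definition transl :: "'a \<Rightarrow> 'a \<times> real \<Rightarrow> 'a \<times> real" where
  "transl l x = (fst x, snd x + fst x \<bullet> l)"

abbreviation coroot :: "'a \<Rightarrow> 'a" where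
  "coroot \<alpha> \<equiv> (2 / (\<alpha> \<bullet> \<alpha>)) *\<^sub>R \<alpha>"

lemma transl_add: "transl (l + m) = transl l \<circ> transl m"
  by (rule ext) (simp add: transl_def inner_add_right)

lemma transl_zero: "transl 0 = id"
  by (rule ext) (simp add: transl_def)

text \<open>Two reflections in parallel hyperplanes, at consecutive integer levels of \<alpha>,
  compose to a translation.\<close>

lemma transl_coroot:
  assumes "\<alpha> \<in> \<Phi>"
  shows "transl (coroot \<alpha>) \<in> words"
proof -
  have "transl (coroot \<alpha>) = aff_refl (\<alpha>, 0) \<circ> aff_refl (\<alpha>, -1)"
  proof
    fix x :: "'a \<times> real"
    show "transl (coroot \<alpha>) x = (aff_refl (\<alpha>, 0) \<circ> aff_refl (\<alpha>, -1)) x"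
      using root_nonzero[OF assms]
      by (cases x) (simp add: transl_def aff_refl_pair inner_simps field_simps flip: scaleR_left_distrib)
  qed
  also have "\<dots> \<in> words"
    using assms by (intro words_comp refl_in_words) (auto simp: roots_iff)
  finally show ?thesis .
qed

lemma transl_sum:
  assumes "\<And>i. i \<in> I \<Longrightarrow> transl (f i) \<in> words"
  shows "transl (sum f I) \<in> words"
  using assms
proof (induction I rule: infinite_finite_induct)
  case (insert i I)
  then have "transl (f i) \<circ> transl (sum f I) \<in> words" by (intro words_comp) auto
  then show ?case using insert.hyps by (simp only: sum.insert transl_add not_False_eq_True)
qed (simp_all only: sum.infinite sum.empty transl_zero words_id not_False_eq_True)

lemma transl_of_nat:
  assumes "transl l \<in> words"
  shows "transl (real n *\<^sub>R l) \<in> words"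
  using transl_sum[of "{..<n}" "\<lambda>_. l"] assms by (simp add: sum_constant_scaleR)

lemma inv_transl: "inv_map (transl l) = transl (- l)"
proof (rule inv_unique_comp)
  show "transl l \<circ> transl (- l) = id" "transl (- l) \<circ> transl l = id"
    using transl_zero by (simp_all flip: transl_add)
qed

lemma transl_uminus:
  assumes "transl l \<in> words"
  shows "transl (- l) \<in> words"
  using words_inv[OF assms] by (simp only: inv_transl)

lemma transl_of_int:
  assumes "transl l \<in> words"
  shows "transl (real_of_int n *\<^sub>R l) \<in> words"
proof (cases "n \<ge> 0")
  case True
  then show ?thesis using transl_of_nat[OF assms, of "nat n"] by simp
next
  case False
  then show ?thesis using transl_uminus[OF transl_of_nat[OF assms, of "nat (- n)"]] by simp
qed

section \<open>Inversion sets of translations\<close>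

lemma inv_set_transl: "(\<beta>, r) \<in> inv_set (transl l) \<longleftrightarrow> (\<beta>, r) \<in> Pos \<and> - (\<beta>, r - \<beta> \<bullet> l) \<in> Pos"
  unfolding inv_set_iff inv_transl by (simp add: transl_def)

text \<open>The inverse translation moves the root from a height at or above
  \<open>bottom \<beta>\<close> to one below it, and \<open>\<beta> \<bullet> l\<close> is the
  amount of this drop.\<close>

lemma inv_set_transl_inner_pos:
  assumes "(\<beta>, r) \<in> inv_set (transl l)"
  shows "\<beta> \<in> \<Phi>" "\<beta> \<bullet> l > 0"
proof -
  obtain n m where "n \<ge> bottom \<beta>" "r = real_of_int n" "m < bottom \<beta>" "r - \<beta> \<bullet> l = real_of_int m"
    using assms unfolding inv_set_transl Pos_iff Neg_iff by blast
  then have "\<beta> \<bullet> l = real_of_int (n - m)" "n > m" by auto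
  then show "\<beta> \<bullet> l > 0" by simp
  show "\<beta> \<in> \<Phi>" using assms unfolding inv_set_transl Pos_iff by blast
qed

text \<open>Along the string over \<alpha> the heights drop by m times the positive integer
  \<open>c\<close>, hence by at least m, so the lowest m roots of the string are inverted.\<close>

lemma card_inv_set_transl:
  assumes l: "transl l \<in> words" and a: "\<alpha> \<in> \<Phi>" "\<alpha> \<bullet> l > 0"
  shows "m \<le> card (inv_set (transl (real m *\<^sub>R l)))"
proof -
  \<comment> \<open>The pairing is an integer because the translation maps roots to roots.\<close>
  have "transl l (\<alpha>, 0) \<in> roots" using words_roots[OF l] a by (simp add: roots_iff)
  then obtain c :: int where c: "\<alpha> \<bullet> l = real_of_int c" by (auto simp: transl_def roots_iff Ints_def)
  let ?f = "\<lambda>j::nat. (\<alpha>, real_of_int (bottom \<alpha> + int j))"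
  have "?f ` {..<m} \<subseteq> inv_set (transl (real m *\<^sub>R l))"
  proof clarify
    fix j assume j: "j < m"
    have "c \<ge> 1" using a c by simp
    then have "int m * 1 \<le> int m * c" by (intro mult_left_mono) auto
    then have lt: "bottom \<alpha> + int j - int m * c < bottom \<alpha>" using j by linarith
    have "real_of_int (bottom \<alpha> + int j) - \<alpha> \<bullet> (real m *\<^sub>R l) = real_of_int (bottom \<alpha> + int j - int m * c)"
      by (simp add: c)
    then show "?f j \<in> inv_set (transl (real m *\<^sub>R l))"
      unfolding inv_set_transl Pos_iff Neg_iff using a lt by (metis le_add_same_cancel1 of_nat_0_le_iff)
  qed
  then have "card (?f ` {..<m}) \<le> card (inv_set (transl (real m *\<^sub>R l)))"
    by (intro card_mono finite_inv_set transl_of_nat l)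
  moreover have "card (?f ` {..<m}) = m" by (subst card_image) (auto simp: inj_on_def)
  ultimately show ?thesis by simp
qed

section \<open>Walks in the Cayley graph\<close>

abbreviation "twlen \<equiv> twisted_length \<Phi> \<Delta> \<rho>"

lemma twlen_words:
  "w \<in> words \<Longrightarrow> twlen B w = int (card (inv_set w)) - 2 * int (card (inv_set w \<inter> B))"
  by (simp add: twisted_length_def aff_length_inv_set)

lemma card_insert_diff:
  assumes "finite N" "g \<notin> N"
  shows "\<bar>(int (card (insert g N)) - 2 * int (card (insert g N \<inter> B)))
          - (int (card N) - 2 * int (card (N \<inter> B)))\<bar> \<le> 1"
  using assms by (cases "g \<in> B") (auto simp: Int_insert_left)

lemma twlen_step:
  assumes w: "w \<in> words" and s: "s \<in> simple_refls"
  shows "\<bar>twlen B (w \<circ> s) - twlen B w\<bar> \<le> 1"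
proof -
  obtain a where a: "a \<in> simple_roots" "s = aff_refl a" using s by (rule simple_reflsE)
  have ws: "w \<circ> aff_refl a \<in> words" by (intro words_comp words_simple w a)
  show ?thesis
  proof (cases "w a \<in> Pos")
    case True
    then show ?thesis
      using card_insert_diff[OF finite_inv_set[OF w], of "w a" B] inv_set_step[OF w a(1)]
      unfolding twlen_words[OF w] twlen_words[OF ws] a(2) by metis
  next
    case False
    then show ?thesis
      using card_insert_diff[OF finite_inv_set[OF ws], of "- w a" B] inv_set_step_neg[OF w a(1)]
      unfolding twlen_words[OF w] twlen_words[OF ws] a(2) by (metis abs_minus_commute)
  qed
qed

lemma twlen_word_bound:
  assumes "w \<in> words" "set ss \<subseteq> simple_refls"
  shows "\<bar>twlen B (w \<circ> word ss) - twlen B w\<bar> \<le> int (length ss)"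
  using assms
proof (induction ss arbitrary: w)
  case Nil
  then show ?case by (simp add: word_Nil)
next
  case (Cons s ss)
  have s: "s \<in> simple_refls" using Cons.prems by simp
  then have "w \<circ> s \<in> words" using Cons.prems by (elim simple_reflsE) (metis words_comp words_simple)
  then have "\<bar>twlen B (w \<circ> s \<circ> word ss) - twlen B (w \<circ> s)\<bar> \<le> int (length ss)"
    using Cons.prems(2) by (intro Cons.IH[OF \<open>w \<circ> s \<in> words\<close>]) auto
  then show ?case using twlen_step[OF Cons.prems(1) s, of B] unfolding word_Cons comp_assoc
    by (simp only: list.size)
qed

text \<open>The prefixes of \<open>ss\<close> form a walk on which the value changes by at most 1
  per step, so it cannot jump over \<open>k\<close>.\<close>

lemma twlen_intermediate:
  assumes "w \<in> words" "set ss \<subseteq> simple_refls"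
    and "k \<le> twlen B w" "twlen B (w \<circ> word ss) \<le> k"
  shows "\<exists>i\<le>length ss. twlen B (w \<circ> word (take i ss)) = k"
  using assms
proof (induction ss arbitrary: w)
  case Nil
  then show ?case by (intro exI[of _ 0]) (simp add: word_Nil)
next
  case (Cons s ss)
  have s: "s \<in> simple_refls" using Cons.prems by simp
  have ws: "w \<circ> s \<in> words" using s Cons.prems by (elim simple_reflsE) (metis words_comp words_simple)
  show ?case
  proof (cases "k \<le> twlen B (w \<circ> s)")
    case True
    have "\<exists>i\<le>length ss. twlen B ((w \<circ> s) \<circ> word (take i ss)) = k"
      using Cons.prems unfolding word_Cons by (intro Cons.IH[OF ws _ True]) (auto simp: comp_assoc)
    then obtain i where "i \<le> length ss" "twlen B ((w \<circ> s) \<circ> word (take i ss)) = k" by blast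
    then show ?thesis
      by (intro exI[of _ "Suc i"]) (simp add: word_Cons comp_assoc del: o_apply)
  next
    case False
    then have "twlen B w = k" using twlen_step[OF Cons.prems(1) s, of B] Cons.prems(3) by linarith
    then show ?thesis by (intro exI[of _ 0]) (simp add: word_Nil)
  qed
qed

section \<open>Biclosed sets and their asymptotic directions\<close>

text \<open>Asking for infinitely many heights gives a notion that applies equally to
  \<open>B\<close> and to its complement; for biclosed \<open>B\<close> it means that the string is
  eventually in \<open>B\<close>, by \<open>inf_dirs_complement\<close>.\<close>

definition inf_dirs :: "('a \<times> real) set \<Rightarrow> 'a set" where
  "inf_dirs X = {\<beta> \<in> \<Phi>. infinite {r. (\<beta>, r) \<in> X}}"

text \<open>Arbitrary multiples of \<beta> are allowed so that a reflected root is reached in one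
  step, without passing through the roots in between.\<close>

definition add_closed :: "'a set \<Rightarrow> bool" where
  "add_closed X \<longleftrightarrow> X \<subseteq> \<Phi> \<and>
     (\<forall>\<alpha>\<in>X. \<forall>\<beta>\<in>X. \<forall>n::nat. \<alpha> + real n *\<^sub>R \<beta> \<in> \<Phi> \<longrightarrow> \<alpha> + real n *\<^sub>R \<beta> \<in> X)"

text \<open>Adding n copies of one fixed root of \<open>X\<close> over \<beta> maps the infinite
  part of \<open>X\<close> over \<alpha> injectively into the string over the sum.\<close>

lemma inf_dirs_add_closed:
  assumes X: "closed_roots \<Phi> \<Delta> X"
  shows "add_closed (inf_dirs X)"
  unfolding add_closed_def
proof (intro conjI ballI allI impI)
  fix \<alpha> \<beta> n
  assume a: "\<alpha> \<in> inf_dirs X" and b: "\<beta> \<in> inf_dirs X" and ab: "\<alpha> + real n *\<^sub>R \<beta> \<in> \<Phi>"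
  have sub: "X \<subseteq> roots" using X by (simp add: closed_roots_def)
  have "{r. (\<beta>, r) \<in> X} \<noteq> {}" using b unfolding inf_dirs_def by (metis (mono_tags) finite.emptyI mem_Collect_eq)
  then obtain m where m: "(\<beta>, m) \<in> X" by blast
  let ?f = "\<lambda>r. r + real n * m"
  have "?f ` {r. (\<alpha>, r) \<in> X} \<subseteq> {r. (\<alpha> + real n *\<^sub>R \<beta>, r) \<in> X}"
  proof clarify
    fix r assume r: "(\<alpha>, r) \<in> X"
    have "r \<in> \<int>" "m \<in> \<int>" using r m sub roots_iff by blast+
    then have "1 *\<^sub>R (\<alpha>, r) + real n *\<^sub>R (\<beta>, m) \<in> roots" using ab by (simp add: roots_iff)
    then have "1 *\<^sub>R (\<alpha>, r) + real n *\<^sub>R (\<beta>, m) \<in> X"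
      using X r m unfolding closed_roots_def by (metis of_nat_0_le_iff zero_le_one)
    then show "(\<alpha> + real n *\<^sub>R \<beta>, ?f r) \<in> X" by simp
  qed
  moreover have "infinite (?f ` {r. (\<alpha>, r) \<in> X})"
    using a by (subst finite_image_iff) (auto simp: inf_dirs_def inj_on_def)
  ultimately have "infinite {r. (\<alpha> + real n *\<^sub>R \<beta>, r) \<in> X}" using infinite_super by blast
  then show "\<alpha> + real n *\<^sub>R \<beta> \<in> inf_dirs X" using ab by (simp add: inf_dirs_def)
qed (auto simp: inf_dirs_def)

lemma inf_dirs_unbounded:
  assumes X: "X \<subseteq> Pos" and b: "\<beta> \<in> inf_dirs X"
  shows "\<exists>r>c. (\<beta>, r) \<in> X"
proof (rule ccontr)
  assume no: "\<not> ?thesis"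
  have "{r. (\<beta>, r) \<in> X} \<subseteq> real_of_int ` {bottom \<beta>..\<lfloor>c\<rfloor>}"
  proof clarify
    fix r assume r: "(\<beta>, r) \<in> X"
    then obtain n where n: "n \<ge> bottom \<beta>" "r = real_of_int n" using X Pos_iff by blast
    moreover have "r \<le> c" using no r by force
    ultimately show "r \<in> real_of_int ` {bottom \<beta>..\<lfloor>c\<rfloor>}" by (auto simp: le_floor_iff)
  qed
  then show False using b by (auto simp: inf_dirs_def dest: finite_subset)
qed

text \<open>Finitely many directions with finitely many heights each. These exceptional roots
  account for the bounded error in \<open>twlen_direction\<close>.\<close>

lemma finite_off_inf_dirs:
  assumes "X \<subseteq> Pos"
  shows "finite {\<gamma> \<in> X. fst \<gamma> \<notin> inf_dirs X}"
proof -
  have "{\<gamma> \<in> X. fst \<gamma> \<notin> inf_dirs X} \<subseteq> (SIGMA \<beta>:\<Phi> - inf_dirs X. {r. (\<beta>, r) \<in> X})"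
    using assms Pos_iff by auto
  moreover have "finite (SIGMA \<beta>:\<Phi> - inf_dirs X. {r. (\<beta>, r) \<in> X})"
    using finite_roots by (intro finite_SigmaI) (auto simp: inf_dirs_def)
  ultimately show ?thesis by (rule finite_subset)
qed

lemma inf_dirs_nonempty:
  assumes "X \<subseteq> Pos" "infinite X"
  shows "inf_dirs X \<noteq> {}"
  using finite_off_inf_dirs[OF assms(1)] assms(2) by auto

text \<open>The root at height \<open>s\<close> is a convex combination of those at heights
  \<open>r\<close> and \<open>t\<close>.\<close>

lemma closed_convex:
  assumes X: "closed_roots \<Phi> \<Delta> X" and r: "(\<beta>, r) \<in> X" "(\<beta>, t) \<in> X" and s: "r < s" "s < t" "(\<beta>, s) \<in> roots"
  shows "(\<beta>, s) \<in> X"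
proof -
  let ?k = "(s - r) / (t - r)"
  have k: "?k \<ge> 0" "1 - ?k \<ge> 0" using s by (auto simp: field_simps)
  have "?k * (t - r) = s - r" using s by simp
  then have "(1 - ?k) * r + ?k * t = s" by algebra
  then have eq: "(1 - ?k) *\<^sub>R (\<beta>, r) + ?k *\<^sub>R (\<beta>, t) = (\<beta>, s)" by (simp flip: scaleR_left_distrib)
  then have "(1 - ?k) *\<^sub>R (\<beta>, r) + ?k *\<^sub>R (\<beta>, t) \<in> roots" using s by simp
  then have "(1 - ?k) *\<^sub>R (\<beta>, r) + ?k *\<^sub>R (\<beta>, t) \<in> X"
    using X r k unfolding closed_roots_def by blast
  then show ?thesis unfolding eq .
qed

text \<open>If both sets met a string infinitely often, a root outside \<open>B\<close> would lie
  between two roots of \<open>B\<close>, against \<open>closed_convex\<close>. If both met it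
  finitely often, the string would be finite.\<close>

lemma inf_dirs_complement:
  assumes B: "biclosed_roots \<Phi> \<Delta> B"
  shows "inf_dirs (Pos - B) = \<Phi> - inf_dirs B"
proof -
  have sub: "B \<subseteq> Pos" "Pos - B \<subseteq> Pos" and cl: "closed_roots \<Phi> \<Delta> B"
    using B by (auto simp: biclosed_roots_def)
  have "\<beta> \<notin> inf_dirs B" if b: "\<beta> \<in> inf_dirs (Pos - B)" for \<beta>
  proof
    assume b': "\<beta> \<in> inf_dirs B"
    obtain r where r: "(\<beta>, r) \<in> B" using inf_dirs_unbounded[OF sub(1) b'] by blast
    obtain s where s: "s > r" "(\<beta>, s) \<in> Pos - B" using inf_dirs_unbounded[OF sub(2) b] by blast
    obtain t where t: "t > s" "(\<beta>, t) \<in> B" using inf_dirs_unbounded[OF sub(1) b'] by blast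
    have "(\<beta>, s) \<in> roots" using s roots_split by blast
    then have "(\<beta>, s) \<in> B" using closed_convex[OF cl r t(2) s(1) t(1)] by blast
    then show False using s by blast
  qed
  moreover have "\<beta> \<in> inf_dirs (Pos - B)" if b: "\<beta> \<in> \<Phi>" "\<beta> \<notin> inf_dirs B" for \<beta>
  proof -
    have "infinite (real_of_int ` {bottom \<beta>..})"
      by (subst finite_image_iff) (auto simp: inj_on_def infinite_Ici)
    moreover have "real_of_int ` {bottom \<beta>..} \<subseteq> {r. (\<beta>, r) \<in> B} \<union> {r. (\<beta>, r) \<in> Pos - B}"
      using b Pos_iff by auto
    moreover have "finite {r. (\<beta>, r) \<in> B}" using b by (simp add: inf_dirs_def)
    ultimately show ?thesis using b by (auto simp: inf_dirs_def dest: finite_subset)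
  qed
  ultimately show ?thesis by (auto simp: inf_dirs_def)
qed

section \<open>Closed partitions of the finite root system\<close>

lemma fin_refl_uminus: "fin_refl (- \<beta>) \<alpha> = fin_refl \<beta> \<alpha>"
  by simp

lemma fin_refl_neg: "fin_refl \<beta> (- \<alpha>) = - fin_refl \<beta> \<alpha>"
  by simp

lemma fin_refl_invol: "\<beta> \<in> \<Phi> \<Longrightarrow> fin_refl \<beta> (fin_refl \<beta> \<alpha>) = \<alpha>"
  using root_nonzero[of \<beta>] by (simp add: inner_simps field_simps flip: scaleR_left_distrib)

lemma fin_refl_inner: "\<beta> \<in> \<Phi> \<Longrightarrow> fin_refl \<beta> \<alpha> \<bullet> \<beta> = - (\<alpha> \<bullet> \<beta>)"
  using root_nonzero[of \<beta>] by (simp add: inner_simps)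

lemma fin_refl_norm: "\<beta> \<in> \<Phi> \<Longrightarrow> fin_refl \<beta> \<alpha> \<bullet> fin_refl \<beta> \<alpha> = \<alpha> \<bullet> \<alpha>"
  using inner_reflection[of \<beta>] root_nonzero by blast

text \<open>At a non-acute angle the reflection adds a nonnegative integer multiple of
  \<beta>.\<close>

lemma add_closed_refl_obtuse:
  assumes X: "add_closed X" and a: "\<alpha> \<in> X" "\<beta> \<in> X" and neg: "\<alpha> \<bullet> \<beta> \<le> 0"
  shows "fin_refl \<beta> \<alpha> \<in> X"
proof -
  have r: "\<alpha> \<in> \<Phi>" "\<beta> \<in> \<Phi>" using X a by (auto simp: add_closed_def)
  obtain c :: int where c: "pairing \<alpha> \<beta> = real_of_int c" using pairing_Ints[OF r(2,1)] by (auto simp: Ints_def)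
  have "pairing \<alpha> \<beta> \<le> 0" using neg by (simp add: divide_nonpos_nonneg)
  then have "fin_refl \<beta> \<alpha> = \<alpha> + real (nat (- c)) *\<^sub>R \<beta>" using c by simp
  then show ?thesis using X a fin_refl_root[OF r(2,1)] unfolding add_closed_def by metis
qed

text \<open>At an acute angle, \<open>- \<beta>\<close> defines the same reflection and makes the
  angle obtuse.\<close>

lemma add_closed_refl:
  assumes X: "add_closed X" and a: "\<alpha> \<in> X" "\<beta> \<in> X" "- \<beta> \<in> X"
  shows "fin_refl \<beta> \<alpha> \<in> X"
proof (cases "\<alpha> \<bullet> \<beta> \<le> 0")
  case False
  then have "fin_refl (- \<beta>) \<alpha> \<in> X" using X a by (intro add_closed_refl_obtuse) auto
  then show ?thesis unfolding fin_refl_uminus .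
qed (rule add_closed_refl_obtuse[OF assms(1-3)])

text \<open>The finite roots split into this set, its negatives, and the roots \<beta> for which
  \<beta> and \<open>- \<beta>\<close> are both in \<open>P\<close> or both outside.\<close>

definition one_sided :: "'a set \<Rightarrow> 'a set" where
  "one_sided P = {\<alpha> \<in> P. - \<alpha> \<notin> P}"

text \<open>Otherwise \<open>P\<close> and its complement would both be closed and stable under
  negation. A root \<alpha> of \<open>P\<close> at an obtuse angle to a root \<beta> outside would
  have \<open>\<alpha> + \<beta>\<close> as a root or zero: as a root it could lie on neither side,
  and zero would put \<beta> into \<open>P\<close>. So the two sides would be orthogonal, against
  irreducibility.\<close>

lemma one_sided_nonempty:
  assumes irr: "irreducible_root_system \<Phi>"
    and P: "add_closed P" "add_closed (\<Phi> - P)" "P \<noteq> {}" "\<Phi> - P \<noteq> {}"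
  shows "one_sided P \<noteq> {}"
proof
  assume "one_sided P = {}"
  then have symP: "- \<alpha> \<in> P" if "\<alpha> \<in> P" for \<alpha> using that by (auto simp: one_sided_def)
  have symQ: "- \<alpha> \<in> \<Phi> - P" if "\<alpha> \<in> \<Phi> - P" for \<alpha>
    using that symP[of "- \<alpha>"] root_uminus by auto
  have PF: "P \<subseteq> \<Phi>" using P by (simp add: add_closed_def)
  have add: "\<alpha> + \<beta> \<in> X" if "add_closed X" "\<alpha> \<in> X" "\<beta> \<in> X" "\<alpha> + \<beta> \<in> \<Phi>" for \<alpha> \<beta> X
    using that unfolding add_closed_def by (metis of_nat_1 scaleR_one)
  have obtuse: False if a: "\<alpha> \<in> P" and b: "\<beta> \<in> \<Phi> - P" and neg: "\<alpha> \<bullet> \<beta> < 0" for \<alpha> \<beta>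
  proof -
    have r: "\<alpha> \<in> \<Phi>" "\<beta> \<in> \<Phi>" using a b PF by auto
    \<comment> \<open>Adding \<open>- \<alpha>\<close> would bring \<beta> into \<open>P\<close>;
      for the complement, adding \<open>- \<beta>\<close> would bring \<alpha> into it.\<close>
    have sP: "\<alpha> + \<beta> \<notin> P"
      using add[OF P(1), of "- \<alpha>" "\<alpha> + \<beta>"] symP[OF a] b by (auto)
    have sQ: "\<alpha> + \<beta> \<notin> \<Phi> - P"
      using add[OF P(2), of "\<alpha> + \<beta>" "- \<beta>"] symQ[OF b] a r by auto
    obtain c d :: int where cd: "pairing \<alpha> \<beta> = real_of_int c" "pairing \<beta> \<alpha> = real_of_int d"
      using pairing_Ints r by (metis Ints_cases)
    have nz: "\<alpha> \<bullet> \<alpha> > 0" "\<beta> \<bullet> \<beta> > 0" using root_nonzero r by auto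
    have "pairing \<alpha> \<beta> < 0" "pairing \<beta> \<alpha> < 0"
      using neg nz inner_commute[of \<alpha> \<beta>] by (simp_all add: divide_neg_pos)
    then have "c < 0" "d < 0" unfolding cd by simp_all
    \<comment> \<open>A pairing of -1 would make \<open>\<alpha> + \<beta>\<close> a reflected root.
      With both integers at most -2, the squared norm of \<open>\<alpha> + \<beta>\<close> is at
      most 0.\<close>
    have "c \<noteq> -1"
      using fin_refl_root[OF r(2,1)] sP sQ cd(1) by auto
    moreover have "d \<noteq> -1"
      using fin_refl_root[OF r(1,2)] sP sQ cd(2) by (auto simp: add.commute)
    ultimately have "c \<le> -2" "d \<le> -2" using \<open>c < 0\<close> \<open>d < 0\<close> by auto
    then have "real_of_int c \<le> -2" "real_of_int d \<le> -2" by simp_all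
    then have "2 * (\<alpha> \<bullet> \<beta>) \<le> -2 * (\<beta> \<bullet> \<beta>)" "2 * (\<beta> \<bullet> \<alpha>) \<le> -2 * (\<alpha> \<bullet> \<alpha>)"
      unfolding cd[symmetric] using nz by (simp_all only: divide_le_eq if_True)
    then have "(\<alpha> + \<beta>) \<bullet> (\<alpha> + \<beta>) \<le> 0" using inner_commute[of \<alpha> \<beta>] by (simp add: inner_simps)
    then have "\<alpha> + \<beta> = 0" by (metis inner_eq_zero_iff inner_ge_zero order_antisym)
    then have "\<beta> = - \<alpha>" by (simp add: eq_neg_iff_add_eq_0 add.commute)
    then show False using symP[OF a] b by auto
  qed
  have "\<alpha> \<bullet> \<beta> = 0" if "\<alpha> \<in> P" "\<beta> \<in> \<Phi> - P" for \<alpha> \<beta>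
    using obtuse[OF that] obtuse[OF that(1) symQ[OF that(2)]] by force
  moreover have "P \<union> (\<Phi> - P) = \<Phi>" "P \<inter> (\<Phi> - P) = {}" using PF by auto
  ultimately have "\<exists>\<Phi>1 \<Phi>2. \<Phi>1 \<noteq> {} \<and> \<Phi>2 \<noteq> {} \<and> \<Phi>1 \<union> \<Phi>2 = \<Phi> \<and> \<Phi>1 \<inter> \<Phi>2 = {} \<and>
         (\<forall>\<alpha>\<in>\<Phi>1. \<forall>\<beta>\<in>\<Phi>2. \<alpha> \<bullet> \<beta> = 0)"
    using P(3,4) by (intro exI[of _ P] exI[of _ "\<Phi> - P"] conjI ballI)
  then show False
    using irr by (simp only: irreducible_root_system_def simp_thms)
qed

section \<open>The direction that separates the one-sided roots from their negatives\<close>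

context
  fixes P :: "'a set"
  assumes P: "add_closed P" and Q: "add_closed (\<Phi> - P)"
begin

text \<open>Coroots are summed, rather than roots, so that \<open>transl_coroot\<close> puts the
  translation by the sum into \<open>words\<close>. For a positive system \<open>P\<close> this is
  the sum of the positive coroots.\<close>

definition "direction = (\<Sum>\<alpha>\<in>one_sided P. coroot \<alpha>)"

lemma one_sided_root: "\<alpha> \<in> one_sided P \<Longrightarrow> \<alpha> \<in> \<Phi>"
  using P by (auto simp: one_sided_def add_closed_def)

lemma finite_asym: "finite (one_sided P)"
  using finite_roots one_sided_root by (meson finite_subset subsetI)

text \<open>The reflection in \<beta> preserves the side that contains \<beta> and
  \<open>- \<beta>\<close>. Being an involution of the roots, it preserves the other side as well,
  and it commutes with negation.\<close>

lemma one_sided_refl_symmetric: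
  assumes a: "\<alpha> \<in> one_sided P" and b: "\<beta> \<in> \<Phi>" "\<beta> \<notin> one_sided P" "- \<beta> \<notin> one_sided P"
  shows "fin_refl \<beta> \<alpha> \<in> one_sided P"
proof -
  have r: "\<alpha> \<in> \<Phi>" "- \<alpha> \<in> \<Phi>" "- \<beta> \<in> \<Phi>" using one_sided_root[OF a] b root_uminus by auto
  have aP: "\<alpha> \<in> P" "- \<alpha> \<notin> P" using a by (auto simp: one_sided_def)
  define s where "s = fin_refl \<beta>"
  have s_neg: "s (- \<gamma>) = - s \<gamma>" and s_invol: "s (s \<gamma>) = \<gamma>" for \<gamma>
    unfolding s_def by (rule fin_refl_neg, rule fin_refl_invol[OF b(1)])
  have sr: "s \<alpha> \<in> \<Phi>" "- s \<alpha> \<in> \<Phi>"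
    using fin_refl_root[OF b(1) r(1)] by (simp_all only: root_uminus s_def)
  have "s \<alpha> \<in> P \<and> - s \<alpha> \<notin> P"
  proof (cases "\<beta> \<in> P")
    case True
    then have "- \<beta> \<in> P" using b by (simp add: one_sided_def)
    then have stable: "s \<gamma> \<in> P" if "\<gamma> \<in> P" for \<gamma>
      unfolding s_def by (rule add_closed_refl[OF P that True])
    have "- s \<alpha> \<notin> P"
      using stable[of "- s \<alpha>"] aP(2) by (auto simp: s_neg s_invol)
    then show ?thesis using stable[OF aP(1)] by blast
  next
    case False
    then have q: "\<beta> \<in> \<Phi> - P" "- \<beta> \<in> \<Phi> - P" using b r by (auto simp: one_sided_def)
    have stable: "s \<gamma> \<in> \<Phi> - P" if "\<gamma> \<in> \<Phi> - P" for \<gamma>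
      unfolding s_def by (rule add_closed_refl[OF Q that q])
    have "- s \<alpha> \<in> \<Phi> - P" using stable[of "- \<alpha>"] aP r by (simp add: s_neg)
    moreover have "s \<alpha> \<notin> \<Phi> - P" using stable[of "s \<alpha>"] aP(1) by (auto simp: s_invol)
    ultimately show ?thesis using sr by blast
  qed
  then show ?thesis unfolding one_sided_def s_def by blast
qed

text \<open>If the negative of the reflected root were in \<open>P\<close>, it would again form a
  non-acute angle with \<alpha>, and reflecting it back would put \<open>- \<beta>\<close> into
  \<open>P\<close>.\<close>

lemma one_sided_refl_obtuse:
  assumes a: "\<alpha> \<in> one_sided P" and b: "\<beta> \<in> one_sided P" and neg: "\<beta> \<bullet> \<alpha> \<le> 0"
  shows "fin_refl \<alpha> \<beta> \<in> one_sided P"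
proof -
  have aP: "\<alpha> \<in> P" "\<beta> \<in> P" "- \<beta> \<notin> P" using a b by (auto simp: one_sided_def)
  have "fin_refl \<alpha> \<beta> \<in> P" by (rule add_closed_refl_obtuse[OF P aP(2,1) neg])
  moreover have "- fin_refl \<alpha> \<beta> \<notin> P"
  proof
    assume n: "- fin_refl \<alpha> \<beta> \<in> P"
    have "- fin_refl \<alpha> \<beta> \<bullet> \<alpha> \<le> 0"
      using neg fin_refl_inner[OF one_sided_root[OF a], of \<beta>] by (simp only: inner_minus_left minus_minus)
    then have "fin_refl \<alpha> (- fin_refl \<alpha> \<beta>) \<in> P" by (rule add_closed_refl_obtuse[OF P n aP(1)])
    then show False using aP(3) fin_refl_invol[OF one_sided_root[OF a], of \<beta>] by (simp only: fin_refl_neg)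
  qed
  ultimately show ?thesis unfolding one_sided_def by blast
qed

lemma direction_inner: "direction \<bullet> \<alpha> = (\<Sum>\<beta>\<in>one_sided P. 2 * (\<beta> \<bullet> \<alpha>) / (\<beta> \<bullet> \<beta>))"
  by (simp add: direction_def inner_sum_left)

text \<open>The reflection in \<beta> permutes the one-sided roots, keeps their norms and negates
  their products with \<beta>, so the sum equals its own negative.\<close>

lemma direction_symmetric:
  assumes b: "\<beta> \<in> \<Phi>" "\<beta> \<notin> one_sided P" "- \<beta> \<notin> one_sided P"
  shows "direction \<bullet> \<beta> = 0"
proof -
  let ?f = "\<lambda>\<alpha>. 2 * (\<alpha> \<bullet> \<beta>) / (\<alpha> \<bullet> \<alpha>)"
  have "bij_betw (fin_refl \<beta>) (one_sided P) (one_sided P)"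
  proof (rule bij_betw_byWitness[where f'="fin_refl \<beta>"])
    show "fin_refl \<beta> ` one_sided P \<subseteq> one_sided P"
      by (intro image_subsetI one_sided_refl_symmetric[OF _ b])
  qed (intro ballI fin_refl_invol[OF b(1)], intro ballI fin_refl_invol[OF b(1)],
       intro image_subsetI one_sided_refl_symmetric[OF _ b])
  then have "sum ?f (one_sided P) = (\<Sum>\<alpha>\<in>one_sided P. ?f (fin_refl \<beta> \<alpha>))"
    by (rule sum.reindex_bij_betw[symmetric])
  also have "\<dots> = - sum ?f (one_sided P)"
    unfolding fin_refl_norm[OF b(1)] fin_refl_inner[OF b(1)] by (simp add: sum_negf)
  finally show ?thesis by (simp add: direction_inner)
qed

text \<open>The terms of the pairing with \<open>\<alpha>\<close> that are negative cancel against their images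
  under the reflection in \<open>\<alpha>\<close>, while the term of \<open>\<alpha>\<close> itself stays.\<close>

lemma direction_one_sided:
  assumes a: "\<alpha> \<in> one_sided P"
  shows "direction \<bullet> \<alpha> > 0"
proof -
  have ar: "\<alpha> \<in> \<Phi>" by (rule one_sided_root[OF a])
  let ?f = "\<lambda>\<beta>. 2 * (\<beta> \<bullet> \<alpha>) / (\<beta> \<bullet> \<beta>)"
  define N where "N = {\<beta> \<in> one_sided P. \<beta> \<bullet> \<alpha> < 0}"
  define M where "M = fin_refl \<alpha> ` N"
  have N: "N \<subseteq> one_sided P" by (auto simp: N_def)
  have M: "M \<subseteq> one_sided P" using one_sided_refl_obtuse[OF a] unfolding M_def N_def by force
  have Mpos: "\<beta> \<bullet> \<alpha> > 0" if m: "\<beta> \<in> M" for \<beta>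
  proof -
    obtain \<gamma> where g: "\<gamma> \<bullet> \<alpha> < 0" "\<beta> = fin_refl \<alpha> \<gamma>" using m unfolding M_def N_def by blast
    then show ?thesis using fin_refl_inner[OF ar, of \<gamma>] by simp
  qed
  have fin: "finite N" "finite M" "finite (one_sided P)"
    using finite_asym N M finite_subset by blast+
  have "inj_on (fin_refl \<alpha>) N" by (rule inj_on_inverseI[of _ "fin_refl \<alpha>"]) (rule fin_refl_invol[OF ar])
  then have "sum ?f M = (\<Sum>\<beta>\<in>N. ?f (fin_refl \<alpha> \<beta>))"
    unfolding M_def by (subst sum.reindex) (simp_all only: o_def)
  also have "\<dots> = - sum ?f N"
    unfolding fin_refl_norm[OF ar] fin_refl_inner[OF ar] by (simp add: sum_negf)
  finally have MN: "sum ?f M + sum ?f N = 0" by simp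
  have disj: "N \<inter> M = {}" using Mpos by (force simp: N_def)
  have "sum ?f (one_sided P) = sum ?f (one_sided P - (N \<union> M)) + sum ?f (N \<union> M)"
    using fin N M by (intro sum.subset_diff) auto
  also have "sum ?f (N \<union> M) = 0"
    using MN disj fin by (simp add: sum.union_disjoint add.commute)
  also have "sum ?f (one_sided P - (N \<union> M)) + 0 > 0"
  proof -
    have "\<alpha> \<notin> N" by (simp add: N_def not_less)
    moreover have "\<alpha> \<notin> M"
    proof
      assume "\<alpha> \<in> M"
      then obtain \<gamma> where g: "\<gamma> \<in> one_sided P" "\<alpha> = fin_refl \<alpha> \<gamma>" unfolding M_def N_def by blast
      have "fin_refl \<alpha> \<alpha> = - \<alpha>" using root_nonzero[OF ar] by (simp add: scaleR_2)
      then have "\<gamma> = - \<alpha>" using g(2) fin_refl_invol[OF ar, of \<gamma>] by metis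
      then show False using a g by (simp add: one_sided_def)
    qed
    ultimately have "\<alpha> \<in> one_sided P - (N \<union> M)" using a by blast
    moreover have "?f \<beta> \<ge> 0" if "\<beta> \<in> one_sided P - (N \<union> M)" for \<beta>
      using that by (auto simp: N_def)
    moreover have "?f \<alpha> > 0" using root_nonzero[OF ar] by simp
    ultimately have "sum ?f (one_sided P - (N \<union> M)) > 0"
      using fin by (intro sum_pos2[of _ \<alpha>]) auto
    then show ?thesis by simp
  qed
  finally show ?thesis unfolding direction_inner .
qed

text \<open>In the threefold splitting of the roots, the other two classes pair with the direction
  to zero or to a negative number.\<close>

lemma direction_inner_pos:
  assumes "\<beta> \<in> \<Phi>" "\<beta> \<bullet> direction > 0"
  shows "\<beta> \<in> one_sided P"
proof (rule ccontr)
  assume n: "\<beta> \<notin> one_sided P"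
  then have "- \<beta> \<in> one_sided P" using direction_symmetric[of \<beta>] assms by (auto simp: inner_commute)
  then show False using direction_one_sided[of "- \<beta>"] assms by (simp add: inner_commute)
qed

lemma transl_direction: "transl direction \<in> words"
  unfolding direction_def by (intro transl_sum transl_coroot one_sided_root)

end

section \<open>Level sets of the twisted length\<close>

text \<open>A positive multiple of \<open>d\<close> inverts only roots over directions in
  \<open>P\<close>, a negative multiple only roots over directions outside \<open>P\<close>.
  Inversions on the wrong side of \<open>B\<close> thus lie in the fixed finite set \<open>Z\<close>
  or \<open>Z'\<close>, while the total number of inversions is at least m.\<close>

lemma twlen_direction:
  assumes B: "biclosed_roots \<Phi> \<Delta> B" and ne: "one_sided (inf_dirs B) \<noteq> {}"
    and d: "d = direction (inf_dirs B)"
  shows "\<exists>C. \<forall>m. twlen B (transl (real m *\<^sub>R d)) \<le> C - int m"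
    and "\<exists>C. \<forall>m. twlen B (transl (- (real m *\<^sub>R d))) \<ge> int m - C"
proof -
  define P where "P = inf_dirs B"
  have sub: "B \<subseteq> Pos" "Pos - B \<subseteq> Pos" and cl: "closed_roots \<Phi> \<Delta> B" "closed_roots \<Phi> \<Delta> (Pos - B)"
    using B by (auto simp: biclosed_roots_def)
  have compl: "inf_dirs (Pos - B) = \<Phi> - P" using inf_dirs_complement[OF B] P_def by simp
  have P: "add_closed P" "add_closed (\<Phi> - P)"
    using inf_dirs_add_closed[OF cl(1)] inf_dirs_add_closed[OF cl(2)] compl P_def by auto
  have d: "d = direction P" using d P_def by simp
  have td: "transl d \<in> words" unfolding d by (rule transl_direction[OF P])
  obtain \<alpha> where a: "\<alpha> \<in> one_sided P" using ne P_def by blast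
  have ar: "\<alpha> \<in> \<Phi>" by (rule one_sided_root[OF P a])
  have ad: "\<alpha> \<bullet> d > 0" using direction_one_sided[OF P a] by (simp add: d inner_commute)
  define Z where "Z = {\<gamma> \<in> Pos - B. fst \<gamma> \<notin> inf_dirs (Pos - B)}"
  define Z' where "Z' = {\<gamma> \<in> B. fst \<gamma> \<notin> inf_dirs B}"
  have fin: "finite Z" "finite Z'"
    unfolding Z_def Z'_def using finite_off_inf_dirs sub by blast+
  \<comment> \<open>In this form a bound on the inversions outside \<open>B\<close> bounds the
    twisted length from above.\<close>
  have split: "twlen B w = 2 * int (card (inv_set w - B)) - int (card (inv_set w))"
    if "w \<in> words" for w
    using twlen_words[OF that, of B] card_Int_Diff[OF finite_inv_set[OF that], of B] by simp
  have "twlen B (transl (real m *\<^sub>R d)) \<le> 2 * int (card Z) - int m" for m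
  proof -
    let ?w = "transl (real m *\<^sub>R d)"
    have w: "?w \<in> words" by (rule transl_of_nat[OF td])
    have "inv_set ?w - B \<subseteq> Z"
    proof clarify
      fix \<beta> r assume g: "(\<beta>, r) \<in> inv_set ?w" "(\<beta>, r) \<notin> B"
      have "\<beta> \<bullet> d > 0" using inv_set_transl_inner_pos(2)[OF g(1)] by (simp add: zero_less_mult_iff)
      then have "\<beta> \<in> P" using direction_inner_pos[OF P, of \<beta>] inv_set_transl_inner_pos(1)[OF g(1)]
        unfolding d by (simp add: one_sided_def)
      then show "(\<beta>, r) \<in> Z" using g unfolding Z_def compl by (simp add: inv_set_iff)
    qed
    then have "card (inv_set ?w - B) \<le> card Z" by (rule card_mono[OF fin(1)])
    then show ?thesis using split[OF w] card_inv_set_transl[OF td ar ad, of m] by simp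
  qed
  then show "\<exists>C. \<forall>m. twlen B (transl (real m *\<^sub>R d)) \<le> C - int m" by blast
  have "twlen B (transl (- (real m *\<^sub>R d))) \<ge> int m - 2 * int (card Z')" for m
  proof -
    let ?w = "transl (- (real m *\<^sub>R d))"
    have w: "?w \<in> words" by (rule transl_uminus[OF transl_of_nat[OF td]])
    have "inv_set ?w \<inter> B \<subseteq> Z'"
    proof clarify
      fix \<beta> r assume g: "(\<beta>, r) \<in> inv_set ?w" "(\<beta>, r) \<in> B"
      have "- \<beta> \<bullet> d > 0" using inv_set_transl_inner_pos(2)[OF g(1)] by (simp add: mult_less_0_iff)
      then have "- \<beta> \<in> one_sided P" using direction_inner_pos[OF P, of "- \<beta>"] inv_set_transl_inner_pos(1)[OF g(1)]
        unfolding d by (simp add: root_uminus)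
      then show "(\<beta>, r) \<in> Z'" using g unfolding Z'_def P_def by (simp add: one_sided_def)
    qed
    then have "card (inv_set ?w \<inter> B) \<le> card Z'" by (rule card_mono[OF fin(2)])
    moreover have "m \<le> card (inv_set ?w)"
      using card_inv_set_transl[OF transl_uminus[OF td], of "- \<alpha>" m] ar ad by (simp add: root_uminus)
    ultimately show ?thesis using twlen_words[OF w, of B] by simp
  qed
  then show "\<exists>C. \<forall>m. twlen B (transl (- (real m *\<^sub>R d))) \<ge> int m - C" by blast
qed

text \<open>On the translations by \<open>l + i d\<close> the twisted length is below
  \<open>k\<close> for large positive i and at least \<open>k\<close> for large negative i. Between
  two neighbours where it crosses \<open>k\<close>, the word \<open>ss\<close> of the translation by
  \<open>d\<close> is a walk of fixed length that attains \<open>k\<close>.\<close>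

lemma level_on_line:
  assumes B: "biclosed_roots \<Phi> \<Delta> B" and ne: "one_sided (inf_dirs B) \<noteq> {}"
    and d: "d = direction (inf_dirs B)" "transl d \<in> words"
    and ss: "set ss \<subseteq> simple_refls" "transl d = word ss"
    and l: "transl l \<in> words"
  shows "\<exists>i::int. \<exists>j\<le>length ss.
           twlen B (transl l \<circ> transl (real_of_int i *\<^sub>R d) \<circ> word (take j ss)) = k"
proof -
  define g where "g i = twlen B (transl (l + real_of_int i *\<^sub>R d))" for i :: int
  obtain ts where ts: "set ts \<subseteq> simple_refls" "transl l = word ts"
    using l by (auto simp: words_def)
  have near: "\<bar>g i - twlen B (transl (real_of_int i *\<^sub>R d))\<bar> \<le> int (length ts)" for i
  proof -
    \<comment> \<open>Translations commute, so the shift by \<open>l\<close> can be moved to the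
      right, where it costs at most the length of its word, whatever i is.\<close>
    have "transl (l + real_of_int i *\<^sub>R d) = transl (real_of_int i *\<^sub>R d) \<circ> word ts"
      unfolding ts(2)[symmetric] by (simp only: add.commute flip: transl_add)
    then show ?thesis
      using twlen_word_bound[OF transl_of_int[OF d(2)] ts(1), of B i] unfolding g_def by simp
  qed
  obtain C C' where C: "\<And>m. twlen B (transl (real m *\<^sub>R d)) \<le> C - int m"
      "\<And>m. twlen B (transl (- (real m *\<^sub>R d))) \<ge> int m - C'"
    using twlen_direction[OF B ne d(1)] by blast
  \<comment> \<open>Large enough to absorb both constants, the level \<open>k\<close> and the cost
    of the shift by \<open>l\<close>.\<close>
  define M where "M = nat (\<bar>C\<bar> + \<bar>C'\<bar> + \<bar>k\<bar> + int (length ts) + 1)"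
  have M: "int M = \<bar>C\<bar> + \<bar>C'\<bar> + \<bar>k\<bar> + int (length ts) + 1" by (simp add: M_def)
  have hi: "g (int M) < k"
    using near[of "int M"] C(1)[of M] M unfolding of_int_of_nat_eq by linarith
  have lo: "g (- int M) \<ge> k"
    using near[of "- int M"] C(2)[of M] M unfolding of_int_minus of_int_of_nat_eq scaleR_minus_left
    by linarith
  have "\<exists>i. k \<le> g i \<and> g (i + 1) \<le> k"
  proof (rule ccontr)
    \<comment> \<open>Without a crossing, a value of at least \<open>k\<close> would propagate from
      \<open>- int M\<close> up to \<open>int M\<close>.\<close>
    assume no: "\<not> ?thesis"
    have "k \<le> g (int M)"
      by (rule int_ge_induct[of "- int M" _ "\<lambda>i. k \<le> g i"]) (use lo no in force)+
    then show False using hi by simp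
  qed
  then obtain i where i: "k \<le> g i" "g (i + 1) \<le> k" by blast
  let ?w = "transl (l + real_of_int i *\<^sub>R d)"
  have w: "?w \<in> words" unfolding transl_add by (intro words_comp l transl_of_int d)
  have "?w \<circ> word ss = transl (l + real_of_int i *\<^sub>R d + d)"
    by (simp only: transl_add ss(2))
  also have "l + real_of_int i *\<^sub>R d + d = l + real_of_int (i + 1) *\<^sub>R d"
    by (simp add: scaleR_left_distrib)
  finally have "twlen B (?w \<circ> word ss) \<le> k" using i(2) unfolding g_def by metis
  then have "\<exists>j\<le>length ss. twlen B (?w \<circ> word (take j ss)) = k"
    using twlen_intermediate[OF w ss(1), of k B] i(1) unfolding g_def by blast
  then show ?thesis unfolding transl_add by blast
qed

text \<open>There is at most one simple reflection more than there are roots in \<Delta>.\<close>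

lemma two_le_card_Delta:
  assumes "aff_rank \<Delta> \<rho> \<ge> 3"
  shows "card \<Delta> \<ge> 2"
proof -
  have "card (aff_simple_refls \<Delta> \<rho>) \<le> card simple_roots"
    unfolding aff_simple_refls_def by (rule card_image_le[OF finite_simple_roots])
  also have "\<dots> \<le> card ((\<lambda>\<alpha>. (\<alpha>, 0::real)) ` \<Delta>) + 1"
    unfolding aff_simple_roots_def using card_Un_le[of "(\<lambda>\<alpha>. (\<alpha>, 0::real)) ` \<Delta>" "{delta - (\<rho>, 0)}"] by simp
  also have "\<dots> \<le> card \<Delta> + 1" using card_image_le[OF finite_Delta] by simp
  finally show ?thesis using assms by (simp add: aff_rank_def)
qed

text \<open>The points of a finite level set would move the finitely many preimages of \<open>(x, 0)\<close> to
  finitely many places, but on the line through the translation by \<open>n \<mu>\<close> they move one of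
  them to height \<open>n (x \<bullet> \<mu>)\<close>.\<close>

lemma infinite_level_set:
  assumes irr: "irreducible_root_system \<Phi>" and rank: "aff_rank \<Delta> \<rho> \<ge> 3"
    and B: "biclosed_roots \<Phi> \<Delta> B" "infinite B" "infinite (Pos - B)"
  shows "infinite {w \<in> aff_weyl_group \<Phi> \<Delta>. twlen B w = k}"
proof
  assume "finite {w \<in> aff_weyl_group \<Phi> \<Delta>. twlen B w = k}" (is "finite ?S")
  define P where "P = inf_dirs B"
  have sub: "B \<subseteq> Pos" "Pos - B \<subseteq> Pos" and cl: "closed_roots \<Phi> \<Delta> B" "closed_roots \<Phi> \<Delta> (Pos - B)"
    using B by (auto simp: biclosed_roots_def)
  have compl: "inf_dirs (Pos - B) = \<Phi> - P" using inf_dirs_complement[OF B(1)] P_def by simp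
  have P: "add_closed P" "add_closed (\<Phi> - P)" "P \<noteq> {}" "\<Phi> - P \<noteq> {}"
    using inf_dirs_add_closed[OF cl(1)] inf_dirs_add_closed[OF cl(2)]
      inf_dirs_nonempty[OF sub(1) B(2)] inf_dirs_nonempty[OF sub(2) B(3)] compl P_def by auto
  have ne: "one_sided P \<noteq> {}" by (rule one_sided_nonempty[OF irr P])
  define d where "d = direction P"
  have td: "transl d \<in> words" unfolding d_def by (rule transl_direction[OF P(1,2)])
  have "d \<noteq> 0" using ne direction_one_sided[OF P(1,2)] unfolding d_def by force
  \<comment> \<open>This is where the rank enters: two independent simple roots do not fit on one
    line.\<close>
  have "\<not> \<Delta> \<subseteq> span {d}"
  proof
    assume "\<Delta> \<subseteq> span {d}"
    then have "card \<Delta> \<le> card {d}" using independent_span_bound[OF _ Delta_indep, of "{d}"] by simp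
    then show False using two_le_card_Delta[OF rank] by simp
  qed
  then obtain \<alpha> where a: "\<alpha> \<in> \<Delta>" "\<alpha> \<notin> span {d}" by blast
  \<comment> \<open>The component of \<alpha> orthogonal to \<open>d\<close>: translations along
    \<open>d\<close> fix \<open>(x, 0)\<close>, whereas translation by the coroot of \<alpha> moves
    it.\<close>
  define x where "x = \<alpha> - ((\<alpha> \<bullet> d) / (d \<bullet> d)) *\<^sub>R d"
  have xd: "x \<bullet> d = 0" using \<open>d \<noteq> 0\<close> by (simp add: x_def inner_simps)
  have "x \<noteq> 0" using a by (auto simp: x_def span_singleton)
  moreover have "x \<bullet> \<alpha> = x \<bullet> x"
    using xd by (simp add: x_def inner_simps)
  ultimately have xa: "x \<bullet> coroot \<alpha> \<noteq> 0" using a root_nonzero Delta_sub by auto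
  let ?\<mu> = "coroot \<alpha>"
  have tm: "transl ?\<mu> \<in> words" using a Delta_sub by (intro transl_coroot) auto
  obtain ss where ss: "set ss \<subseteq> simple_refls" "transl d = word ss" using td by (auto simp: words_def)
  define y where "y j = inv_map (word (take j ss)) (x, 0)" for j
  let ?pts = "(\<lambda>(w, j). w (y j)) ` (?S \<times> {..length ss})"
  have "(x, real n * (x \<bullet> ?\<mu>)) \<in> ?pts" for n
  proof -
    obtain i j where j: "j \<le> length ss"
      "twlen B (transl (real n *\<^sub>R ?\<mu>) \<circ> transl (real_of_int i *\<^sub>R d) \<circ> word (take j ss)) = k" (is "twlen B ?w = k")
      using level_on_line[OF B(1) ne[unfolded P_def] d_def[unfolded P_def] td ss transl_of_nat[OF tm]] by blast
    have u: "word (take j ss) \<in> words"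
      using ss(1) set_take_subset[of j ss] unfolding words_def by blast
    have w: "?w \<in> words" by (intro words_comp transl_of_nat transl_of_int tm td u)
    have "?w (y j) = transl (real n *\<^sub>R ?\<mu>) (transl (real_of_int i *\<^sub>R d) (x, 0))"
      unfolding y_def using words_bij[OF u] by (simp add: bij_is_surj surj_f_inv_f)
    also have "\<dots> = (x, real n * (x \<bullet> ?\<mu>))" by (simp add: transl_def xd)
    finally have "(x, real n * (x \<bullet> ?\<mu>)) = (\<lambda>(w, j). w (y j)) (?w, j)" by simp
    moreover have "(?w, j) \<in> ?S \<times> {..length ss}" using words_in_group[OF w] j by blast
    ultimately show ?thesis by (rule image_eqI)
  qed
  then have "range (\<lambda>n::nat. (x, real n * (x \<bullet> ?\<mu>))) \<subseteq> ?pts" by blast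
  moreover have "finite ?pts" using \<open>finite ?S\<close> by simp
  ultimately have "finite (range (\<lambda>n::nat. (x, real n * (x \<bullet> ?\<mu>))))" by (rule finite_subset)
  moreover have "inj (\<lambda>n::nat. (x, real n * (x \<bullet> ?\<mu>)))" using xa by (intro injI) auto
  ultimately show False using finite_imageD by blast
qed

end

theorem theorem5p5:
  fixes \<Phi> \<Delta> :: "'a::euclidean_space set" and \<rho> :: 'a
    and B :: "('a \<times> real) set" and k :: int
  assumes "irreducible_root_system \<Phi>"
    and "simple_system \<Phi> \<Delta>"
    and "highest_root \<Phi> \<Delta> \<rho>"
    and "aff_rank \<Delta> \<rho> \<ge> 3"
    and "biclosed_roots \<Phi> \<Delta> B"
    and "infinite B"
    and "infinite (aff_pos_roots \<Phi> \<Delta> - B)"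
  shows "infinite {w \<in> aff_weyl_group \<Phi> \<Delta>. twisted_length \<Phi> \<Delta> \<rho> B w = k}"
proof -
  interpret affine_root_datum \<Phi> \<Delta> \<rho>
    using assms by unfold_locales (auto simp: irreducible_root_system_def)
  show ?thesis using assms by (intro infinite_level_set)
qed

end
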